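(* Let $\Theta_1$ and $\Theta_2$ be finite Blaschke products, each having $n$ distinct zeros. Then the quotient algebras $H^\infty/\Theta_1H^\infty$ and $H^\infty/\Theta_2H^\infty$ are isometrically isomorphic if and only if there are a unimodular constant $\zeta$ and a disk automorphism $\psi$ such that $\Theta_1 = \zeta\,\Theta_2\circ\psi$.
   Context: $H^\infty$ is the Banach algebra of bounded analytic functions on the open unit disk $\mathbb{D}$ with the supremum norm, and $H^\infty/\Theta H^\infty$ carries the quotient norm. "A finite Blaschke product with $n$ distinct zeros" means a Blaschke product of degree $n\geq 1$ all of whose zeros are simple. Isometrically isomorphic means there is a norm-preserving algebra isomorphism of one algebra onto the other. A disk automorphism is a biholomorphic map $\mathbb{D}\to\mathbb{D}$. *)

theory Defs
  imports "HOL-Complex_Analysis.Complex_Analysis" "HOL-Algebra.Algebraic_Closure_Type"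
begin

section \<open>The algebra of bounded analytic functions on the unit disk\<close>

abbreviation unit_disk :: "complex set" where
  "unit_disk \<equiv> ball 0 1"

text \<open>A function on the disk is represented by a total function that takes the default value
  \<^const>\<open>undefined\<close> outside of it, so that equality of elements is equality on the disk.\<close>

definition Hinf :: "(complex, complex \<Rightarrow> complex) module" where
  "Hinf = \<lparr>carrier = {f \<in> extensional unit_disk. f holomorphic_on unit_disk \<and> bounded (f ` unit_disk)},
           mult = (\<lambda>f g. \<lambda>z\<in>unit_disk. f z * g z),
           one = (\<lambda>z\<in>unit_disk. 1),
           zero = (\<lambda>z\<in>unit_disk. 0),
           add = (\<lambda>f g. \<lambda>z\<in>unit_disk. f z + g z),
           smult = (\<lambda>c f. \<lambda>z\<in>unit_disk. c * f z)\<rparr>"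

definition sup_norm :: "(complex \<Rightarrow> complex) \<Rightarrow> real" where
  "sup_norm f = (SUP z\<in>unit_disk. cmod (f z))"


section \<open>Quotient algebras and isometric isomorphisms\<close>

text \<open>\<^const>\<open>FactRing\<close> only yields a ring. The scalar multiplication on cosets is added in the style of
  \<^const>\<open>rcoset_mult\<close>: the product of \<open>c\<close> with the coset of \<open>f\<close> is the coset of \<open>c f\<close>
  (also for \<open>c = 0\<close>, where the elementwise product would not be a coset).\<close>

definition quotient_algebra ::
  "('c, 'a, 'm) module_scheme \<Rightarrow> 'a set \<Rightarrow> ('c, 'a set) module" where
  "quotient_algebra A I =
     ring.extend (A Quot I) (module.fields (\<lambda>c C. \<Union>f\<in>C. I +>\<^bsub>A\<^esub> (c \<odot>\<^bsub>A\<^esub> f)))"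

definition quotient_norm :: "('a \<Rightarrow> real) \<Rightarrow> 'a set \<Rightarrow> real" where
  "quotient_norm N C = (INF f\<in>C. N f)"

definition algebra_iso ::
  "('c, 'a, 'm) module_scheme \<Rightarrow> ('c, 'b, 'n) module_scheme \<Rightarrow> ('a \<Rightarrow> 'b) set" where
  "algebra_iso A B =
     {h \<in> ring_iso A B. \<forall>c. \<forall>x\<in>carrier A. h (c \<odot>\<^bsub>A\<^esub> x) = c \<odot>\<^bsub>B\<^esub> h x}"

definition isometrically_isomorphic ::
  "(complex, 'a, 'm) module_scheme \<Rightarrow> ('a \<Rightarrow> real) \<Rightarrow>
   (complex, 'b, 'n) module_scheme \<Rightarrow> ('b \<Rightarrow> real) \<Rightarrow> bool" where
  "isometrically_isomorphic A N\<^sub>A B N\<^sub>B \<longleftrightarrow>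
     (\<exists>h\<in>algebra_iso A B. \<forall>x\<in>carrier A. N\<^sub>B (h x) = N\<^sub>A x)"

definition Hinf_quotient :: "(complex \<Rightarrow> complex) \<Rightarrow> (complex, (complex \<Rightarrow> complex) set) module" where
  "Hinf_quotient \<Theta> = quotient_algebra Hinf (PIdl\<^bsub>Hinf\<^esub> \<Theta>)"


section \<open>Finite Blaschke products and disk automorphisms\<close>

text \<open>The list \<open>as\<close> contains the zeros, repeated according to multiplicity. The customary
  normalising factors \<open>\<bar>a\<bar> / a\<close> are absorbed in the unimodular constant.\<close>

definition finite_Blaschke_product :: "nat \<Rightarrow> (complex \<Rightarrow> complex) \<Rightarrow> bool" where
  "finite_Blaschke_product n \<Theta> \<longleftrightarrow>
     (\<exists>\<zeta> as. cmod \<zeta> = 1 \<and> length as = n \<and> set as \<subseteq> unit_disk \<and>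
        \<Theta> = (\<lambda>z\<in>unit_disk. \<zeta> * (\<Prod>a\<leftarrow>as. (z - a) / (1 - cnj a * z))))"

definition zeros_simple :: "(complex \<Rightarrow> complex) \<Rightarrow> bool" where
  "zeros_simple \<Theta> \<longleftrightarrow> (\<forall>a\<in>unit_disk. \<Theta> a = 0 \<longrightarrow> zorder \<Theta> a = 1)"

definition Blaschke_with_distinct_zeros :: "nat \<Rightarrow> (complex \<Rightarrow> complex) \<Rightarrow> bool" where
  "Blaschke_with_distinct_zeros n \<Theta> \<longleftrightarrow> finite_Blaschke_product n \<Theta> \<and> zeros_simple \<Theta>"

definition disk_automorphism :: "(complex \<Rightarrow> complex) \<Rightarrow> bool" where
  "disk_automorphism \<psi> \<longleftrightarrow>
     \<psi> holomorphic_on unit_disk \<and> bij_betw \<psi> unit_disk unit_disk \<and>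
     inv_into unit_disk \<psi> holomorphic_on unit_disk"


section \<open>The definitions yield algebras\<close>

lemma Hinf_apply [simp]:
  assumes "z \<in> unit_disk"
  shows "(f \<otimes>\<^bsub>Hinf\<^esub> g) z = f z * g z" "(f \<oplus>\<^bsub>Hinf\<^esub> g) z = f z + g z"
    "\<one>\<^bsub>Hinf\<^esub> z = 1" "\<zero>\<^bsub>Hinf\<^esub> z = 0" "(c \<odot>\<^bsub>Hinf\<^esub> f) z = c * f z"
  using assms by (simp_all add: Hinf_def)

lemma restrict_in_Hinf:
  assumes "h holomorphic_on unit_disk" "\<And>z. z \<in> unit_disk \<Longrightarrow> cmod (h z) \<le> D"
  shows "(\<lambda>z\<in>unit_disk. h z) \<in> carrier Hinf"
  using assms by (force simp: Hinf_def bounded_iff intro: holomorphic_transform)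

lemma Hinf_E:
  assumes "f \<in> carrier Hinf"
  obtains B where "f holomorphic_on unit_disk" "\<And>z. z \<in> unit_disk \<Longrightarrow> cmod (f z) \<le> B"
proof -
  have "f holomorphic_on unit_disk" "bounded (f ` unit_disk)"
    using assms by (simp_all add: Hinf_def)
  then show thesis
    using that unfolding bounded_iff by blast
qed

lemma Hinf_const_closed [simp]:
  shows "\<one>\<^bsub>Hinf\<^esub> \<in> carrier Hinf" "\<zero>\<^bsub>Hinf\<^esub> \<in> carrier Hinf"
  using restrict_in_Hinf[of "\<lambda>_. 1" 1] restrict_in_Hinf[of "\<lambda>_. 0" 0] by (simp_all add: Hinf_def)

lemma Hinf_smult_closed [simp]:
  assumes "f \<in> carrier Hinf"
  shows "c \<odot>\<^bsub>Hinf\<^esub> f \<in> carrier Hinf"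
proof -
  obtain B where f: "f holomorphic_on unit_disk" "\<And>z. z \<in> unit_disk \<Longrightarrow> cmod (f z) \<le> B"
    using Hinf_E[OF assms] by metis
  have "(\<lambda>z\<in>unit_disk. c * f z) \<in> carrier Hinf"
    using f by (intro restrict_in_Hinf[where D = "cmod c * B"] holomorphic_intros)
      (auto simp: norm_mult intro!: mult_left_mono)
  then show ?thesis by (simp add: Hinf_def)
qed

lemma Hinf_closed [simp]:
  assumes "f \<in> carrier Hinf" "g \<in> carrier Hinf"
  shows "f \<oplus>\<^bsub>Hinf\<^esub> g \<in> carrier Hinf" "f \<otimes>\<^bsub>Hinf\<^esub> g \<in> carrier Hinf"
proof -
  obtain B where f: "f holomorphic_on unit_disk" "\<And>z. z \<in> unit_disk \<Longrightarrow> cmod (f z) \<le> B"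
    using Hinf_E[OF assms(1)] by metis
  obtain C where g: "g holomorphic_on unit_disk" "\<And>z. z \<in> unit_disk \<Longrightarrow> cmod (g z) \<le> C"
    using Hinf_E[OF assms(2)] by metis
  have "(\<lambda>z\<in>unit_disk. f z + g z) \<in> carrier Hinf"
    using f g by (intro restrict_in_Hinf[where D = "B + C"] holomorphic_intros norm_triangle_mono)
  then show "f \<oplus>\<^bsub>Hinf\<^esub> g \<in> carrier Hinf" by (simp add: Hinf_def)
  have "(\<lambda>z\<in>unit_disk. f z * g z) \<in> carrier Hinf"
  proof (intro restrict_in_Hinf[where D = "B * C"] holomorphic_intros f g)
    fix z assume z: "z \<in> unit_disk"
    show "cmod (f z * g z) \<le> B * C"
      unfolding norm_mult using f(2)[OF z] g(2)[OF z] order_trans[OF norm_ge_zero f(2)[OF z]]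
      by (intro mult_mono) auto
  qed
  then show "f \<otimes>\<^bsub>Hinf\<^esub> g \<in> carrier Hinf" by (simp add: Hinf_def)
qed

lemma Hinf_eqI:
  assumes "f \<in> carrier Hinf" "g \<in> carrier Hinf" "\<And>z. z \<in> unit_disk \<Longrightarrow> f z = g z"
  shows "f = g"
  using assms by (intro extensionalityI[of f unit_disk g]) (auto simp: Hinf_def)

lemma cring_Hinf: "cring Hinf"
proof (rule cringI)
  show "abelian_group Hinf"
  proof (rule abelian_groupI)
    fix f assume f: "f \<in> carrier Hinf"
    then have "((-1) \<odot>\<^bsub>Hinf\<^esub> f) \<oplus>\<^bsub>Hinf\<^esub> f = \<zero>\<^bsub>Hinf\<^esub>"
      by (intro Hinf_eqI) (simp_all del: mem_ball)
    with f show "\<exists>g\<in>carrier Hinf. g \<oplus>\<^bsub>Hinf\<^esub> f = \<zero>\<^bsub>Hinf\<^esub>"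
      using Hinf_smult_closed by blast
  qed (auto simp: algebra_simps simp del: mem_ball intro!: Hinf_eqI)
  show "Group.comm_monoid Hinf"
    by (rule comm_monoidI) (auto simp: algebra_simps simp del: mem_ball intro!: Hinf_eqI)
qed (auto simp: algebra_simps simp del: mem_ball intro!: Hinf_eqI)

theorem algebra_Hinf: "algebra ring_of_type_algebra Hinf"
proof (rule algebraI)
  show "cring (ring_of_type_algebra :: complex ring)" by (rule cring_from_type_algebra)
qed (auto simp: cring_Hinf ring_of_type_algebra_def algebra_simps
  simp del: mem_ball intro!: Hinf_eqI)

lemma quotient_algebra_sel [simp]:
  "carrier (quotient_algebra A I) = carrier (A Quot I)"
  "mult (quotient_algebra A I) = mult (A Quot I)"
  "one (quotient_algebra A I) = one (A Quot I)"
  "zero (quotient_algebra A I) = zero (A Quot I)"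
  "add (quotient_algebra A I) = add (A Quot I)"
  "smult (quotient_algebra A I) = (\<lambda>c C. \<Union>f\<in>C. I +>\<^bsub>A\<^esub> (c \<odot>\<^bsub>A\<^esub> f))"
  by (simp_all add: quotient_algebra_def ring.defs module.defs)

lemma quotient_smult_coset:
  assumes "algebra K A" "ideal I A" "c \<in> carrier K" "x \<in> carrier A"
  shows "c \<odot>\<^bsub>quotient_algebra A I\<^esub> (I +>\<^bsub>A\<^esub> x) = I +>\<^bsub>A\<^esub> (c \<odot>\<^bsub>A\<^esub> x)"
proof -
  interpret algebra K A by fact
  interpret I: ideal I A by fact
  have "I +>\<^bsub>A\<^esub> (c \<odot>\<^bsub>A\<^esub> f) = I +>\<^bsub>A\<^esub> (c \<odot>\<^bsub>A\<^esub> x)" if f: "f \<in> I +>\<^bsub>A\<^esub> x" for f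
  proof -
    obtain i where i: "i \<in> I" "f = i \<oplus>\<^bsub>A\<^esub> x"
      using f by (auto simp: a_r_coset_def')
    have iA: "i \<in> carrier A" using i(1) I.Icarr by blast
    have "c \<odot>\<^bsub>A\<^esub> i = (c \<odot>\<^bsub>A\<^esub> \<one>\<^bsub>A\<^esub>) \<otimes>\<^bsub>A\<^esub> i"
      using iA assms by (simp add: smult_assoc2)
    then have ci: "c \<odot>\<^bsub>A\<^esub> i \<in> I"
      using i(1) assms by (simp add: I.I_l_closed)
    have "c \<odot>\<^bsub>A\<^esub> f = c \<odot>\<^bsub>A\<^esub> i \<oplus>\<^bsub>A\<^esub> c \<odot>\<^bsub>A\<^esub> x"
      using i iA assms by (simp add: smult_r_distr)
    then have "c \<odot>\<^bsub>A\<^esub> f \<in> I +>\<^bsub>A\<^esub> (c \<odot>\<^bsub>A\<^esub> x)"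
      using ci by (auto simp: a_r_coset_def')
    then show ?thesis
      using I.a_repr_independence'[of _ "c \<odot>\<^bsub>A\<^esub> x"] smult_closed[OF assms(3,4)] by simp
  qed
  moreover have "x \<in> I +>\<^bsub>A\<^esub> x" using I.a_rcos_self assms by blast
  ultimately show ?thesis
    unfolding quotient_algebra_sel by (intro UN_constant_eq ballI)
qed

lemma cring_cong:
  assumes "cring R" "carrier S = carrier R" "mult S = mult R" "one S = one R"
    "zero S = zero R" "add S = add R"
  shows "cring S"
proof -
  interpret R: cring R by fact
  show ?thesis
  proof (rule cringI)
    show "abelian_group S"
    proof (rule abelian_groupI)
      fix x assume "x \<in> carrier S"
      then show "\<exists>y\<in>carrier S. y \<oplus>\<^bsub>S\<^esub> x = \<zero>\<^bsub>S\<^esub>"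
        using R.l_neg R.a_inv_closed assms by auto
    qed (auto simp: assms R.a_ac)
    show "Group.comm_monoid S"
      by (rule comm_monoidI) (auto simp: assms R.m_ac)
  qed (auto simp: assms R.l_distr)
qed

theorem algebra_quotient:
  assumes "algebra K A" "ideal I A"
  shows "algebra K (quotient_algebra A I)"
proof -
  interpret algebra K A by fact
  interpret I: ideal I A by fact
  have coset: "\<exists>x\<in>carrier A. C = I +>\<^bsub>A\<^esub> x" if "C \<in> carrier (A Quot I)" for C
    using that by (auto simp: FactRing_simps)
  have in_Q: "I +>\<^bsub>A\<^esub> x \<in> carrier (A Quot I)" if "x \<in> carrier A" for x
    using that by (auto simp: FactRing_simps)
  have add: "(I +>\<^bsub>A\<^esub> x) \<oplus>\<^bsub>A Quot I\<^esub> (I +>\<^bsub>A\<^esub> y) = I +>\<^bsub>A\<^esub> (x \<oplus>\<^bsub>A\<^esub> y)"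
    if "x \<in> carrier A" "y \<in> carrier A" for x y
    using that by (simp add: FactRing_def I.a_rcos_sum)
  have mult: "(I +>\<^bsub>A\<^esub> x) \<otimes>\<^bsub>A Quot I\<^esub> (I +>\<^bsub>A\<^esub> y) = I +>\<^bsub>A\<^esub> (x \<otimes>\<^bsub>A\<^esub> y)"
    if "x \<in> carrier A" "y \<in> carrier A" for x y
    using that by (simp add: FactRing_def I.rcoset_mult_add)
  note smult = quotient_smult_coset[OF assms]
  show ?thesis
  proof (rule algebraI)
    show "cring (quotient_algebra A I)"
      by (rule cring_cong[OF I.quotient_is_cring[OF M_cring]]) simp_all
  next
    fix a C assume "a \<in> carrier K" "C \<in> carrier (quotient_algebra A I)"
    then show "a \<odot>\<^bsub>quotient_algebra A I\<^esub> C \<in> carrier (quotient_algebra A I)"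
      using coset[of C] by (auto simp: smult in_Q simp del: quotient_algebra_sel(6))
  next
    fix a b C assume "a \<in> carrier K" "b \<in> carrier K" "C \<in> carrier (quotient_algebra A I)"
    then show "(a \<oplus>\<^bsub>K\<^esub> b) \<odot>\<^bsub>quotient_algebra A I\<^esub> C = a \<odot>\<^bsub>quotient_algebra A I\<^esub> C \<oplus>\<^bsub>quotient_algebra A I\<^esub> b \<odot>\<^bsub>quotient_algebra A I\<^esub> C"
      using coset[of C] by (auto simp: smult add smult_l_distr simp del: quotient_algebra_sel(6))
  next
    fix a C D assume "a \<in> carrier K" "C \<in> carrier (quotient_algebra A I)" "D \<in> carrier (quotient_algebra A I)"
    then show "a \<odot>\<^bsub>quotient_algebra A I\<^esub> (C \<oplus>\<^bsub>quotient_algebra A I\<^esub> D) = a \<odot>\<^bsub>quotient_algebra A I\<^esub> C \<oplus>\<^bsub>quotient_algebra A I\<^esub> a \<odot>\<^bsub>quotient_algebra A I\<^esub> D"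
      using coset[of C] coset[of D]
      by (auto simp: smult add smult_r_distr simp del: quotient_algebra_sel(6))
  next
    fix a b C assume "a \<in> carrier K" "b \<in> carrier K" "C \<in> carrier (quotient_algebra A I)"
    then show "(a \<otimes>\<^bsub>K\<^esub> b) \<odot>\<^bsub>quotient_algebra A I\<^esub> C = a \<odot>\<^bsub>quotient_algebra A I\<^esub> (b \<odot>\<^bsub>quotient_algebra A I\<^esub> C)"
      using coset[of C] by (auto simp: smult smult_assoc1 simp del: quotient_algebra_sel(6))
  next
    fix C assume "C \<in> carrier (quotient_algebra A I)"
    then show "\<one>\<^bsub>K\<^esub> \<odot>\<^bsub>quotient_algebra A I\<^esub> C = C"
      using coset[of C] by (auto simp: smult simp del: quotient_algebra_sel(6))
  next
    fix a C D assume "a \<in> carrier K" "C \<in> carrier (quotient_algebra A I)" "D \<in> carrier (quotient_algebra A I)"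
    then show "(a \<odot>\<^bsub>quotient_algebra A I\<^esub> C) \<otimes>\<^bsub>quotient_algebra A I\<^esub> D = a \<odot>\<^bsub>quotient_algebra A I\<^esub> (C \<otimes>\<^bsub>quotient_algebra A I\<^esub> D)"
      using coset[of C] coset[of D]
      by (auto simp: smult mult smult_assoc2 simp del: quotient_algebra_sel(6))
  qed (rule R_cring)
qed

lemma Blaschke_factor_norm:
  assumes "a \<in> unit_disk" "z \<in> unit_disk"
  shows "1 - cnj a * z \<noteq> 0" "cmod ((z - a) / (1 - cnj a * z)) \<le> 1"
proof -
  have "cmod (cnj a * z) < 1"
    using assms mult_strict_mono[of "cmod a" 1 "cmod z" 1] by (simp add: norm_mult)
  then show "1 - cnj a * z \<noteq> 0" by auto
  show "cmod ((z - a) / (1 - cnj a * z)) \<le> 1"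
    using Moebius_function_norm_lt_1[of a z 0] assms by (simp add: Moebius_function_simple)
qed

theorem finite_Blaschke_product_in_Hinf:
  assumes "finite_Blaschke_product n \<Theta>"
  shows "\<Theta> \<in> carrier Hinf"
proof -
  obtain \<zeta> as where \<zeta>: "cmod \<zeta> = 1" and as: "set as \<subseteq> unit_disk"
    and \<Theta>: "\<Theta> = (\<lambda>z\<in>unit_disk. \<zeta> * (\<Prod>a\<leftarrow>as. (z - a) / (1 - cnj a * z)))"
    using assms by (auto simp: finite_Blaschke_product_def)
  have "(\<lambda>z. \<Prod>a\<leftarrow>as. (z - a) / (1 - cnj a * z)) holomorphic_on unit_disk \<and>
    (\<forall>z\<in>unit_disk. cmod (\<Prod>a\<leftarrow>as. (z - a) / (1 - cnj a * z)) \<le> 1)"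
    using as
  proof (induction as)
    case (Cons a as)
    have "(\<lambda>z. (z - a) / (1 - cnj a * z)) holomorphic_on unit_disk"
      using Cons.prems Blaschke_factor_norm(1)[of a] by (intro holomorphic_intros) auto
    moreover have "cmod ((z - a) / (1 - cnj a * z)) \<le> 1" if "z \<in> unit_disk" for z
      using that Cons.prems by (intro Blaschke_factor_norm) auto
    moreover have "(\<lambda>z. \<Prod>a\<leftarrow>as. (z - a) / (1 - cnj a * z)) holomorphic_on unit_disk"
      "\<And>z. z \<in> unit_disk \<Longrightarrow> cmod (\<Prod>a\<leftarrow>as. (z - a) / (1 - cnj a * z)) \<le> 1"
      using Cons by auto
    ultimately show ?case
      unfolding list.map prod_list.Cons norm_mult
      by (intro conjI ballI holomorphic_on_mult mult_le_one norm_ge_zero)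
  qed simp
  then show ?thesis
    unfolding \<Theta> using \<zeta>
    by (intro restrict_in_Hinf[where D = 1] holomorphic_intros) (auto simp: norm_mult)
qed

corollary algebra_Hinf_quotient:
  assumes "finite_Blaschke_product n \<Theta>"
  shows "algebra ring_of_type_algebra (Hinf_quotient \<Theta>)"
  unfolding Hinf_quotient_def
  using algebra_quotient[OF algebra_Hinf cring.cgenideal_ideal[OF cring_Hinf]]
    finite_Blaschke_product_in_Hinf[OF assms] by blast

end

theory Submission
  imports Defs
begin

text \<open>Both quotients are algebras of values on the zero sets \<open>Z\<^sub>1\<close> and \<open>Z\<^sub>2\<close>. If \<open>h\<close> is an isometric
  isomorphism, the class of the identity is mapped to a class that contains, by Montel's theorem, a
  function \<open>\<phi>\<close> bounded by 1. Evaluating \<open>h [f]\<close> at \<open>b \<in> Z\<^sub>2\<close> is a character and therefore equals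
  \<open>f (\<phi> b)\<close>; so \<open>\<phi>\<close> maps \<open>Z\<^sub>2\<close> into \<open>Z\<^sub>1\<close>. The inverse of \<open>h\<close> yields a self-map \<open>\<eta>\<close> of the disk in
  the same way, and \<open>\<phi>\<close> and \<open>\<eta>\<close> are inverse to each other on the zero sets. If there are two or more
  zeros, both composites have two fixed points and are the identity by the Schwarz lemma, so \<open>\<eta>\<close> is
  an automorphism that carries \<open>Z\<^sub>1\<close> onto \<open>Z\<^sub>2\<close>; a single zero can be moved by a Moebius
  transformation. Automorphisms transform Blaschke factors into Blaschke factors up to unimodular
  constants.\<close>

section \<open>Self-maps of the disk\<close>

lemma Moebius_in_unit_disk:
  assumes "a \<in> unit_disk" "z \<in> unit_disk"
  shows "Moebius_function 0 a z \<in> unit_disk"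
  using assms Moebius_function_norm_lt_1[of a z 0] by simp

lemma Moebius_inverse:
  assumes "a \<in> unit_disk" "z \<in> unit_disk"
  shows "Moebius_function 0 (- a) (Moebius_function 0 a z) = z"
    "Moebius_function 0 a (Moebius_function 0 (- a) z) = z"
  using assms by (simp_all add: Moebius_function_compose)

lemma Moebius_eq_0_iff:
  assumes "a \<in> unit_disk" "z \<in> unit_disk"
  shows "Moebius_function 0 a z = 0 \<longleftrightarrow> z = a"
  using Blaschke_factor_norm(1)[OF assms] by (simp add: Moebius_function_simple)

lemma uminus_in_unit_disk [simp]: "a \<in> unit_disk \<Longrightarrow> - a \<in> unit_disk"
  by simp

lemma holomorphic_compose_disk:
  assumes "f holomorphic_on unit_disk" "g holomorphic_on unit_disk"
    and "\<And>z. z \<in> unit_disk \<Longrightarrow> g z \<in> unit_disk"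
  shows "(\<lambda>z. f (g z)) holomorphic_on unit_disk"
proof -
  have "g ` unit_disk \<subseteq> unit_disk" using assms(3) by (rule image_subsetI)
  then show ?thesis
    using holomorphic_on_compose_gen[OF assms(2,1)] by (simp add: o_def)
qed

lemma Moebius_holomorphic:
  "a \<in> unit_disk \<Longrightarrow> Moebius_function 0 a holomorphic_on unit_disk"
  by (simp add: Moebius_function_holomorphic)

lemma disk_automorphismI:
  assumes "f holomorphic_on unit_disk" "g holomorphic_on unit_disk"
    and "\<And>z. z \<in> unit_disk \<Longrightarrow> f z \<in> unit_disk" "\<And>z. z \<in> unit_disk \<Longrightarrow> g z \<in> unit_disk"
    and "\<And>z. z \<in> unit_disk \<Longrightarrow> g (f z) = z" "\<And>z. z \<in> unit_disk \<Longrightarrow> f (g z) = z"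
  shows "disk_automorphism f"
proof -
  have bij: "bij_betw f unit_disk unit_disk"
    using assms(3-6) by (intro bij_betw_byWitness[where f' = g] ballI image_subsetI) assumption+
  have "inv_into unit_disk f z = g z" if "z \<in> unit_disk" for z
    using assms(4)[OF that] assms(6)[OF that] bij by (intro inv_into_f_eq) (auto simp: bij_betw_def)
  then have "inv_into unit_disk f holomorphic_on unit_disk"
    using assms(2) holomorphic_cong[OF refl, of unit_disk "inv_into unit_disk f" g] by metis
  then show ?thesis
    using bij assms(1) by (simp add: disk_automorphism_def)
qed

lemma disk_automorphism_inv_into:
  assumes "disk_automorphism \<psi>"
  defines "\<phi> \<equiv> inv_into unit_disk \<psi>"
  shows "\<psi> holomorphic_on unit_disk" "\<phi> holomorphic_on unit_disk"
    and "\<And>z. z \<in> unit_disk \<Longrightarrow> \<psi> z \<in> unit_disk" "\<And>z. z \<in> unit_disk \<Longrightarrow> \<phi> z \<in> unit_disk"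
    and "\<And>z. z \<in> unit_disk \<Longrightarrow> \<phi> (\<psi> z) = z" "\<And>z. z \<in> unit_disk \<Longrightarrow> \<psi> (\<phi> z) = z"
proof -
  have bij: "bij_betw \<psi> unit_disk unit_disk"
    using assms by (simp add: disk_automorphism_def)
  show "\<psi> holomorphic_on unit_disk" "\<phi> holomorphic_on unit_disk"
    using assms by (simp_all add: disk_automorphism_def)
  show "\<And>z. z \<in> unit_disk \<Longrightarrow> \<psi> z \<in> unit_disk"
    using bij by (rule bij_betw_apply)
  show "\<And>z. z \<in> unit_disk \<Longrightarrow> \<phi> z \<in> unit_disk"
    unfolding \<phi>_def using bij_betw_inv_into[OF bij] by (rule bij_betw_apply)
  show "\<And>z. z \<in> unit_disk \<Longrightarrow> \<phi> (\<psi> z) = z"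
    unfolding \<phi>_def using bij by (rule bij_betw_inv_into_left)
  show "\<And>z. z \<in> unit_disk \<Longrightarrow> \<psi> (\<phi> z) = z"
    unfolding \<phi>_def using bij by (rule bij_betw_inv_into_right)
qed

text \<open>Conjugation with \<open>Moebius_function 0 p\<close> moves the fixed point
  \<open>p\<close> to 0. The other fixed point becomes a nonzero point of equality in the Schwarz
  lemma, so the conjugate is a rotation, and fixing a nonzero point makes its factor 1.\<close>

lemma self_map_two_fixed_points:
  assumes f: "f holomorphic_on unit_disk" "\<And>z. z \<in> unit_disk \<Longrightarrow> f z \<in> unit_disk"
    and pq: "p \<in> unit_disk" "q \<in> unit_disk" "p \<noteq> q" "f p = p" "f q = q" and z: "z \<in> unit_disk"
  shows "f z = z"
proof -
  let ?M = "Moebius_function 0 p" and ?N = "Moebius_function 0 (- p)"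
  define F where "F = (\<lambda>z. ?M (f (?N z)))"
  note M_in = Moebius_in_unit_disk[OF pq(1)]
  note N_in = Moebius_in_unit_disk[OF uminus_in_unit_disk[OF pq(1)]]
  have F_in: "F w \<in> unit_disk" if "w \<in> unit_disk" for w
    unfolding F_def by (rule M_in[OF f(2)[OF N_in[OF that]]])
  have holF: "F holomorphic_on unit_disk"
    unfolding F_def
    using holomorphic_compose_disk[OF Moebius_holomorphic[OF pq(1)]
        holomorphic_compose_disk[OF f(1) Moebius_holomorphic[OF uminus_in_unit_disk[OF pq(1)]] N_in]]
      f(2) N_in by blast
  have FM: "F (?M w) = ?M (f w)" if "w \<in> unit_disk" for w
    using Moebius_inverse(1)[OF pq(1) that] by (simp add: F_def)
  have F0: "F 0 = 0"
    using pq(4) by (simp add: F_def Moebius_function_of_zero Moebius_function_eq_zero)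
  have Fq: "F (?M q) = ?M q" "?M q \<noteq> 0"
    using FM[OF pq(2)] pq Moebius_eq_0_iff[OF pq(1,2)] by auto
  have "\<exists>w. norm w < 1 \<and> w \<noteq> 0 \<and> norm (F w) = norm w"
    using Fq M_in[OF pq(2)] by (intro exI[of _ "?M q"]) simp
  then obtain \<alpha> where \<alpha>: "\<And>w. norm w < 1 \<Longrightarrow> F w = \<alpha> * w"
    using Schwarz_Lemma(3)[OF holF F0, of 0] F_in by auto
  have "\<alpha> = 1"
    using \<alpha>[of "?M q"] Fq M_in[OF pq(2)] by simp
  then have "?M (f z) = ?M z"
    using \<alpha>[of "?M z"] M_in[OF z] FM[OF z] by simp
  then show ?thesis
    using Moebius_inverse(1)[OF pq(1) z] Moebius_inverse(1)[OF pq(1) f(2)[OF z]] by simp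
qed

text \<open>After Moebius changes of variable, \<open>\<psi>\<close> and its inverse become
  self-maps \<open>F\<close> and \<open>K\<close> that fix 0. The Schwarz lemma for both shows that
  \<open>F\<close> preserves moduli, hence is a rotation. This is how a Blaschke factor transforms
  under an automorphism.\<close>

lemma Moebius_disk_automorphism:
  assumes "disk_automorphism \<psi>" and a: "a \<in> unit_disk"
  obtains c where "cmod c = 1"
    "\<And>z. z \<in> unit_disk \<Longrightarrow> Moebius_function 0 (\<psi> a) (\<psi> z) = c * Moebius_function 0 a z"
proof -
  \<comment> \<open>Stated for a general self-map because it serves \<open>\<psi>\<close> and its
    inverse with \<open>a\<close> and \<open>\<psi> a\<close> interchanged.\<close>
  have conj: "(\<lambda>z. Moebius_function 0 c (f (Moebius_function 0 (- d) z))) holomorphic_on unit_disk"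
    "\<And>z. z \<in> unit_disk \<Longrightarrow> Moebius_function 0 c (f (Moebius_function 0 (- d) z)) \<in> unit_disk"
    if cd: "c \<in> unit_disk" "d \<in> unit_disk"
      and f: "f holomorphic_on unit_disk" "\<And>z. z \<in> unit_disk \<Longrightarrow> f z \<in> unit_disk" for c d f
  proof -
    note N_in = Moebius_in_unit_disk[OF uminus_in_unit_disk[OF cd(2)]]
    show "(\<lambda>z. Moebius_function 0 c (f (Moebius_function 0 (- d) z))) holomorphic_on unit_disk"
      using holomorphic_compose_disk[OF Moebius_holomorphic[OF cd(1)]
          holomorphic_compose_disk[OF f(1) Moebius_holomorphic[OF uminus_in_unit_disk[OF cd(2)]] N_in]]
        f(2) N_in by blast
    show "Moebius_function 0 c (f (Moebius_function 0 (- d) z)) \<in> unit_disk" if "z \<in> unit_disk" for z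
      by (rule Moebius_in_unit_disk[OF cd(1) f(2)[OF N_in[OF that]]])
  qed
  define \<phi> where "\<phi> = inv_into unit_disk \<psi>"
  note \<psi> = disk_automorphism_inv_into[OF assms(1), folded \<phi>_def]
  define b where "b = \<psi> a"
  have b: "b \<in> unit_disk" "\<phi> b = a"
    unfolding b_def by (rule \<psi>(3)[OF a], rule \<psi>(5)[OF a])
  let ?M = "Moebius_function 0"
  define F where "F = (\<lambda>z. ?M b (\<psi> (?M (- a) z)))"
  define K where "K = (\<lambda>z. ?M a (\<phi> (?M (- b) z)))"
  have F: "F holomorphic_on ball 0 1" "F 0 = 0" "\<And>z. norm z < 1 \<Longrightarrow> norm (F z) < 1"
    using conj[OF b(1) a \<psi>(1,3), folded F_def]
    by (simp_all add: F_def Moebius_function_of_zero Moebius_function_eq_zero b_def)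
  have K: "K holomorphic_on ball 0 1" "K 0 = 0" "\<And>z. norm z < 1 \<Longrightarrow> norm (K z) < 1"
    using conj[OF a b(1) \<psi>(2,4), folded K_def] b(2)
    by (simp_all add: K_def Moebius_function_of_zero Moebius_function_eq_zero)
  have KF: "K (F z) = z" if z: "z \<in> unit_disk" for z
  proof -
    have w: "?M (- a) z \<in> unit_disk"
      using z a by (intro Moebius_in_unit_disk) auto
    have "?M (- b) (F z) = \<psi> (?M (- a) z)"
      unfolding F_def by (rule Moebius_inverse(1)[OF b(1) \<psi>(3)[OF w]])
    then have "K (F z) = ?M a (\<phi> (\<psi> (?M (- a) z)))"
      unfolding K_def by simp
    then show ?thesis
      using \<psi>(5)[OF w] Moebius_inverse(2)[OF a z] by simp
  qed
  have "norm (F z) = norm z" if z: "norm z < 1" for z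
  proof (rule antisym)
    show "norm (F z) \<le> norm z"
      using Schwarz_Lemma(1)[OF F z] .
    show "norm z \<le> norm (F z)"
      using Schwarz_Lemma(1)[OF K F(3)[OF z]] KF[of z] z by simp
  qed
  \<comment> \<open>The Schwarz lemma asks for equality at one nonzero point; as it holds
    everywhere, 1/2 serves.\<close>
  then have "\<exists>z. norm z < 1 \<and> z \<noteq> 0 \<and> norm (F z) = norm z"
    by (intro exI[of _ "1/2"]) simp
  then obtain c where c: "\<And>z. norm z < 1 \<Longrightarrow> F z = c * z" "norm c = 1"
    using Schwarz_Lemma(3)[OF F, of 0] by auto
  show thesis
  proof (rule that[OF c(2)])
    fix z :: complex assume z: "z \<in> unit_disk"
    have "F (?M a z) = c * ?M a z"
      using c(1) Moebius_in_unit_disk[OF a z] by simp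
    then show "?M (\<psi> a) (\<psi> z) = c * ?M a z"
      using Moebius_inverse(1)[OF a z] by (simp add: F_def b_def)
  qed
qed

text \<open>The map passes through 0: one Moebius function takes \<open>a\<close> to 0, a second
  takes 0 to \<open>b\<close>. It settles the case of a single zero.\<close>

lemma disk_automorphism_moving:
  assumes a: "a \<in> unit_disk" and b: "b \<in> unit_disk"
  obtains \<psi> where "disk_automorphism \<psi>" "\<psi> a = b"
proof -
  let ?M = "Moebius_function 0"
  define \<psi> where "\<psi> = (\<lambda>z. ?M (- b) (?M a z))"
  define \<phi> where "\<phi> = (\<lambda>z. ?M (- a) (?M b z))"
  note M_in = Moebius_in_unit_disk[OF a] Moebius_in_unit_disk[OF b]
    Moebius_in_unit_disk[OF uminus_in_unit_disk[OF a]] Moebius_in_unit_disk[OF uminus_in_unit_disk[OF b]]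
  have "disk_automorphism \<psi>"
  proof (rule disk_automorphismI[of _ \<phi>])
    show "\<psi> holomorphic_on unit_disk" "\<phi> holomorphic_on unit_disk"
      unfolding \<psi>_def \<phi>_def using a b M_in
      by (metis holomorphic_compose_disk Moebius_holomorphic uminus_in_unit_disk)+
    fix z assume z: "z \<in> unit_disk"
    show "\<psi> z \<in> unit_disk" "\<phi> z \<in> unit_disk"
      unfolding \<psi>_def \<phi>_def by (intro M_in z)+
    show "\<phi> (\<psi> z) = z" "\<psi> (\<phi> z) = z"
      using Moebius_inverse[OF a] Moebius_inverse[OF b] M_in z unfolding \<psi>_def \<phi>_def by metis+
  qed
  moreover have "\<psi> a = b"
    by (simp add: \<psi>_def Moebius_function_of_zero Moebius_function_eq_zero)
  ultimately show thesis
    using that by blast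
qed

text \<open>By the maximum modulus principle only a constant can attain modulus 1. A limit from
  Montel's theorem is merely known to be bounded by 1, so the constant case has to be split
  off.\<close>

lemma holomorphic_norm_le_1_cases:
  assumes f: "f holomorphic_on unit_disk" and le: "\<And>z. z \<in> unit_disk \<Longrightarrow> cmod (f z) \<le> 1"
  obtains "\<forall>z\<in>unit_disk. f z \<in> unit_disk" | c where "cmod c = 1" "\<forall>z\<in>unit_disk. f z = c"
proof (cases "\<forall>z\<in>unit_disk. f z \<in> unit_disk")
  case True
  then show thesis by (rule that(1))
next
  case False
  then obtain w where w: "w \<in> unit_disk" "cmod (f w) = 1"
    using le by fastforce
  then have "f constant_on unit_disk"
    using le by (intro maximum_modulus_principle[OF f open_ball connected_ball open_ball order_refl]) auto
  then obtain c where "\<And>z. z \<in> unit_disk \<Longrightarrow> f z = c"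
    by (auto simp: constant_on_def)
  then show thesis
    using w by (intro that(2)[of c]) auto
qed

section \<open>Zeros of bounded analytic functions\<close>

text \<open>The quotient by \<open>z - c\<close> extends holomorphically over \<open>c\<close>. It
  is bounded near \<open>c\<close> by compactness of a closed ball, and elsewhere because
  \<open>z - c\<close> stays away from 0.\<close>

lemma Hinf_divide_zero:
  assumes f: "f \<in> carrier Hinf" and c: "c \<in> unit_disk" "f c = 0"
  obtains q where "q \<in> carrier Hinf" "\<And>z. z \<in> unit_disk \<Longrightarrow> f z = (z - c) * q z"
proof -
  obtain B where B: "f holomorphic_on unit_disk" "\<And>z. z \<in> unit_disk \<Longrightarrow> cmod (f z) \<le> B"
    using Hinf_E[OF f] by metis
  \<comment> \<open>The derivative is the value that removes the singularity at
    \<open>c\<close>.\<close>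
  define q where "q = (\<lambda>z. if z = c then deriv f c else f z / (z - c))"
  have eq: "f z = (z - c) * q z" for z
    using c by (simp add: q_def)
  have q: "q holomorphic_on unit_disk"
    using B(1) open_ball eq by (rule pole_theorem_open_0) (use c in \<open>simp_all add: q_def\<close>)
  obtain r where r: "r > 0" "cball c r \<subseteq> unit_disk"
    using c(1) open_contains_cball open_ball by blast
  have "compact (q ` cball c r)"
    using q r(2) by (intro compact_continuous_image compact_cball)
      (meson holomorphic_on_imp_continuous_on holomorphic_on_subset)
  then obtain C where C: "\<And>z. z \<in> cball c r \<Longrightarrow> cmod (q z) \<le> C"
    using compact_imp_bounded[of "q ` cball c r"] unfolding bounded_iff by (meson imageI)
  have "(\<lambda>z\<in>unit_disk. q z) \<in> carrier Hinf"
  proof (rule restrict_in_Hinf[OF q])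
    fix z assume z: "z \<in> unit_disk"
    show "cmod (q z) \<le> max C (B / r)"
    proof (cases "z \<in> cball c r")
      case False
      then have zr: "cmod (z - c) \<ge> r"
        by (simp add: dist_norm norm_minus_commute)
      then have "cmod (q z) = cmod (f z) / cmod (z - c)"
        using r(1) by (auto simp: q_def norm_divide)
      also have "\<dots> \<le> B / r"
        using B(2)[OF z] zr r(1) by (intro frac_le) (auto intro: order_trans[OF norm_ge_zero])
      finally show ?thesis by simp
    qed (use C in \<open>auto simp: le_max_iff_disj\<close>)
  qed
  then show thesis
    using eq by (intro that[of "\<lambda>z\<in>unit_disk. q z"]) auto
qed

text \<open>The Moebius factor times \<open>1 - cnj c * z\<close> is \<open>z - c\<close>. So the
  quotient by \<open>z - c\<close> only has to be multiplied by \<open>1 - cnj c * z\<close>, which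
  is bounded by 2.\<close>

lemma Hinf_divide_Moebius:
  assumes f: "f \<in> carrier Hinf" and c: "c \<in> unit_disk" "f c = 0"
  obtains q where "q \<in> carrier Hinf" "\<And>z. z \<in> unit_disk \<Longrightarrow> f z = Moebius_function 0 c z * q z"
proof -
  obtain p where p: "p \<in> carrier Hinf" "\<And>z. z \<in> unit_disk \<Longrightarrow> f z = (z - c) * p z"
    using Hinf_divide_zero[OF assms] by metis
  have "cmod (1 - cnj c * z) \<le> 2" if "z \<in> unit_disk" for z
    using that c norm_triangle_ineq4[of 1 "cnj c * z"] mult_mono[of "cmod c" 1 "cmod z" 1]
    by (simp add: norm_mult)
  then have "(\<lambda>z\<in>unit_disk. 1 - cnj c * z) \<in> carrier Hinf"
    by (intro restrict_in_Hinf[where D = 2] holomorphic_intros)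
  from Hinf_closed(2)[OF this p(1)] show thesis
  proof (rule that)
    fix z assume z: "z \<in> unit_disk"
    show "f z = Moebius_function 0 c z * ((\<lambda>z\<in>unit_disk. 1 - cnj c * z) \<otimes>\<^bsub>Hinf\<^esub> p) z"
      using p(2)[OF z] Blaschke_factor_norm(1)[OF c(1) z] z
      by (simp add: Moebius_function_simple del: mem_ball)
  qed
qed

lemma Hinf_divide_Blaschke:
  assumes "finite Z" "Z \<subseteq> unit_disk" "f \<in> carrier Hinf" "\<And>a. a \<in> Z \<Longrightarrow> f a = 0"
  obtains q where "q \<in> carrier Hinf"
    "\<And>z. z \<in> unit_disk \<Longrightarrow> f z = (\<Prod>a\<in>Z. Moebius_function 0 a z) * q z"
proof -
  have "\<exists>q\<in>carrier Hinf. \<forall>z\<in>unit_disk. f z = (\<Prod>a\<in>Z. Moebius_function 0 a z) * q z"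
    using assms
  proof (induction Z arbitrary: f rule: finite_induct)
    case empty
    then show ?case by auto
  next
    case (insert c Z)
    obtain p where p: "p \<in> carrier Hinf" "\<And>z. z \<in> unit_disk \<Longrightarrow> f z = Moebius_function 0 c z * p z"
      using Hinf_divide_Moebius[of f c] insert.prems by auto
    \<comment> \<open>The points of \<open>Z\<close> differ from \<open>c\<close>, so the factor
      split off does not vanish there and the quotient inherits these zeros.\<close>
    have "p a = 0" if a: "a \<in> Z" for a
      using p(2)[of a] insert.prems insert.hyps a Moebius_eq_0_iff[of c a] by auto
    then obtain q where q: "q \<in> carrier Hinf"
      "\<And>z. z \<in> unit_disk \<Longrightarrow> p z = (\<Prod>a\<in>Z. Moebius_function 0 a z) * q z"
      using insert.IH[OF _ p(1)] insert.prems by auto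
    then show ?case
      using p insert.hyps by (intro bexI[of _ q]) (auto simp: mult_ac)
  qed
  then show thesis using that by blast
qed

text \<open>Simplicity of the zeros forces the list of zeros to be distinct, so the product over the
  list becomes a product over a finite set, which fixes the function up to a unimodular
  constant.\<close>

lemma Blaschke_with_distinct_zerosE:
  assumes "Blaschke_with_distinct_zeros n \<Theta>"
  obtains \<zeta> Z where "finite Z" "card Z = n" "Z \<subseteq> unit_disk" "cmod \<zeta> = 1" "\<Theta> \<in> carrier Hinf"
    "\<And>z. z \<in> unit_disk \<Longrightarrow> \<Theta> z = \<zeta> * (\<Prod>a\<in>Z. Moebius_function 0 a z)"
proof -
  obtain \<zeta> as where \<zeta>: "cmod \<zeta> = 1" and as: "length as = n" "set as \<subseteq> unit_disk"
    and \<Theta>: "\<Theta> = (\<lambda>z\<in>unit_disk. \<zeta> * (\<Prod>a\<leftarrow>as. (z - a) / (1 - cnj a * z)))"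
    using assms by (auto simp: Blaschke_with_distinct_zeros_def finite_Blaschke_product_def)
  have Hinf: "\<Theta> \<in> carrier Hinf"
    using assms finite_Blaschke_product_in_Hinf by (auto simp: Blaschke_with_distinct_zeros_def)
  have eq: "\<Theta> z = \<zeta> * (\<Prod>a\<leftarrow>as. Moebius_function 0 a z)" if "z \<in> unit_disk" for z
    using that by (simp add: \<Theta> Moebius_function_simple)
  have "distinct as"
  proof (rule ccontr)
    \<comment> \<open>A repeated zero makes the derivative vanish, whereas it does not vanish at a simple zero.\<close>
    assume "\<not> distinct as"
    then obtain xs ys zs y where decomp: "as = xs @ [y] @ ys @ [y] @ zs"
      using not_distinct_decomp by blast
    have y: "y \<in> unit_disk" using as(2) decomp by auto
    \<comment> \<open>\<open>G\<close> is the cofactor left after both occurrences of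
      \<open>y\<close> are taken out; their two denominators go into it.\<close>
    define G where "G = (\<lambda>z. \<zeta> * (\<Prod>a\<leftarrow>xs @ ys @ zs. Moebius_function 0 a z) / (1 - cnj y * z) ^ 2)"
    have G_eq: "\<Theta> z = (z - y) ^ 2 * G z" if "z \<in> unit_disk" for z
      using eq[OF that] by (simp add: decomp G_def Moebius_function_simple power2_eq_square)
    have "(\<lambda>z. \<Prod>a\<leftarrow>us. Moebius_function 0 a z) holomorphic_on unit_disk"
      if "set us \<subseteq> unit_disk" for us
      using that by (induction us) (auto intro!: holomorphic_intros Moebius_function_holomorphic)
    moreover have "set (xs @ ys @ zs) \<subseteq> unit_disk"
      using as(2) decomp by auto
    ultimately have "G holomorphic_on unit_disk"
      unfolding G_def using Blaschke_factor_norm(1)[OF y]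
      by (intro holomorphic_on_divide holomorphic_on_mult) (auto intro!: holomorphic_intros simp del: map_append)
    then obtain G' where "(G has_field_derivative G') (at y)"
      using y open_ball holomorphic_on_imp_differentiable_at field_differentiable_def by blast
    then have "((\<lambda>z. (z - y) ^ 2 * G z) has_field_derivative 0) (at y)"
      by (auto intro!: derivative_eq_intros)
    then have D0: "(\<Theta> has_field_derivative 0) (at y)"
      by (rule has_field_derivative_transform_within_open[OF _ open_ball y]) (simp add: G_eq)
    \<comment> \<open>The factorisation described by \<open>zorder\<close> requires that the
      function does not vanish identically. A point of the infinite disk outside the finite list
      witnesses this.\<close>
    have "infinite (unit_disk - set as)"
      using y open_ball finite_imp_not_open by (intro Diff_infinite_finite) blast+
    then obtain w where w: "w \<in> unit_disk" "w \<notin> set as"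
      using infinite_imp_nonempty by blast
    then have "\<Theta> w \<noteq> 0"
      using eq[OF w(1)] \<zeta> as(2) Moebius_eq_0_iff by (auto simp: prod_list_zero_iff simp del: mem_ball)
    then have "\<exists>w\<in>unit_disk. \<Theta> w \<noteq> 0" using w(1) by blast
    moreover have "\<Theta> holomorphic_on unit_disk" using Hinf by (auto elim: Hinf_E)
    moreover have "zorder \<Theta> y = 1"
      using assms y G_eq[OF y] by (simp add: Blaschke_with_distinct_zeros_def zeros_simple_def)
    ultimately obtain r where r: "r > 0" "cball y r \<subseteq> unit_disk"
      "zor_poly \<Theta> y holomorphic_on cball y r"
      "\<And>w. w \<in> cball y r \<Longrightarrow> \<Theta> w = zor_poly \<Theta> y w * (w - y) \<and> zor_poly \<Theta> y w \<noteq> 0"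
      using zorder_exist_zero[of \<Theta> unit_disk y] y by auto
    have "zor_poly \<Theta> y holomorphic_on ball y r"
      using r(3) ball_subset_cball holomorphic_on_subset by blast
    then obtain p where "(zor_poly \<Theta> y has_field_derivative p) (at y)"
      using r(1) open_ball holomorphic_on_imp_differentiable_at field_differentiable_def
      by (metis centre_in_ball)
    then have "((\<lambda>w. zor_poly \<Theta> y w * (w - y)) has_field_derivative zor_poly \<Theta> y y) (at y)"
      by (auto intro!: derivative_eq_intros)
    then have "(\<Theta> has_field_derivative zor_poly \<Theta> y y) (at y)"
      by (rule has_field_derivative_transform_within_open[OF _ open_ball[of y r]])
        (use r in auto)
    with D0 have "zor_poly \<Theta> y y = 0"
      using DERIV_unique by blast
    then show False using r(1) r(4)[of y] by auto
  qed
  then have "\<Theta> z = \<zeta> * (\<Prod>a\<in>set as. Moebius_function 0 a z)" if "z \<in> unit_disk" for z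
    using eq[OF that] by (simp add: prod.distinct_set_conv_list)
  with \<open>distinct as\<close> as \<zeta> Hinf show thesis
    using that[of "set as" \<zeta>] by (auto simp: distinct_card)
qed

section \<open>Quotients by ideals of functions vanishing on a set\<close>

interpretation Hinf: cring Hinf
  by (rule cring_Hinf)

definition vanishing_ideal :: "complex set \<Rightarrow> (complex \<Rightarrow> complex) set" where
  "vanishing_ideal Z = {f \<in> carrier Hinf. \<forall>a\<in>Z. f a = 0}"

text \<open>This is the coset of \<open>f\<close> modulo \<open>vanishing_ideal Z\<close>.
  Describing it by values turns equality of cosets into a comparison on \<open>Z\<close>.\<close>

definition value_class :: "complex set \<Rightarrow> (complex \<Rightarrow> complex) \<Rightarrow> (complex \<Rightarrow> complex) set" where
  "value_class Z f = {g \<in> carrier Hinf. \<forall>a\<in>Z. g a = f a}"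

abbreviation value_algebra :: "complex set \<Rightarrow> (complex, (complex \<Rightarrow> complex) set) module" where
  "value_algebra Z \<equiv> quotient_algebra Hinf (vanishing_ideal Z)"

lemma Hinf_minus_apply:
  assumes "f \<in> carrier Hinf" "z \<in> unit_disk"
  shows "(\<ominus>\<^bsub>Hinf\<^esub> f) z = - f z"
proof -
  have "(\<ominus>\<^bsub>Hinf\<^esub> f \<oplus>\<^bsub>Hinf\<^esub> f) z = 0"
    using assms Hinf.l_neg by simp
  then show ?thesis
    using assms(2) by (simp add: add_eq_0_iff2)
qed

lemma ideal_vanishing_ideal:
  assumes "Z \<subseteq> unit_disk"
  shows "ideal (vanishing_ideal Z) Hinf"
proof (intro idealI Hinf.ring_axioms Hinf.add.subgroupI)
  show "vanishing_ideal Z \<subseteq> carrier Hinf"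
    by (auto simp: vanishing_ideal_def)
  have disk: "a \<in> unit_disk" if "a \<in> Z" for a
    using that assms by (rule subsetD[rotated])
  have "\<zero>\<^bsub>Hinf\<^esub> \<in> vanishing_ideal Z"
    by (simp add: vanishing_ideal_def Hinf_apply(4)[OF disk])
  then show "vanishing_ideal Z \<noteq> {}" by blast
  show "\<ominus>\<^bsub>Hinf\<^esub> f \<in> vanishing_ideal Z" if "f \<in> vanishing_ideal Z" for f
    using that Hinf_minus_apply[of f, OF _ disk] by (auto simp: vanishing_ideal_def)
  show "f \<oplus>\<^bsub>Hinf\<^esub> g \<in> vanishing_ideal Z" if "f \<in> vanishing_ideal Z" "g \<in> vanishing_ideal Z" for f g
    using that by (auto simp: vanishing_ideal_def Hinf_apply(2)[OF disk])
  show "g \<otimes>\<^bsub>Hinf\<^esub> f \<in> vanishing_ideal Z" "f \<otimes>\<^bsub>Hinf\<^esub> g \<in> vanishing_ideal Z"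
    if "f \<in> vanishing_ideal Z" "g \<in> carrier Hinf" for f g
    using that by (auto simp: vanishing_ideal_def Hinf_apply(1)[OF disk])
qed

lemma rcoset_vanishing_ideal:
  assumes "Z \<subseteq> unit_disk" "f \<in> carrier Hinf"
  shows "vanishing_ideal Z +>\<^bsub>Hinf\<^esub> f = value_class Z f"
proof (rule Set.set_eqI)
  fix g
  have Z: "a \<in> unit_disk" if "a \<in> Z" for a
    using that assms by blast
  show "g \<in> vanishing_ideal Z +>\<^bsub>Hinf\<^esub> f \<longleftrightarrow> g \<in> value_class Z f"
  proof
    assume "g \<in> vanishing_ideal Z +>\<^bsub>Hinf\<^esub> f"
    then show "g \<in> value_class Z f"
      using assms(2) by (auto simp: a_r_coset_def' vanishing_ideal_def value_class_def Hinf_apply(2)[OF Z])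
  next
    assume g: "g \<in> value_class Z f"
    \<comment> \<open>Subtraction is written as adding the multiple by -1, whose values are given by
      \<open>Hinf_apply\<close>.\<close>
    define d where "d = g \<oplus>\<^bsub>Hinf\<^esub> (-1) \<odot>\<^bsub>Hinf\<^esub> f"
    have "d \<in> vanishing_ideal Z"
      using g assms(2) by (auto simp: d_def value_class_def vanishing_ideal_def Hinf_apply[OF Z])
    moreover have "g = d \<oplus>\<^bsub>Hinf\<^esub> f"
      using g assms(2) unfolding d_def
      by (intro Hinf_eqI) (auto simp: value_class_def simp del: mem_ball)
    ultimately show "g \<in> vanishing_ideal Z +>\<^bsub>Hinf\<^esub> f"
      by (auto simp: a_r_coset_def')
  qed
qed

lemma value_class_eq_iff:
  assumes "f \<in> carrier Hinf" "g \<in> carrier Hinf"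
  shows "value_class Z f = value_class Z g \<longleftrightarrow> (\<forall>a\<in>Z. f a = g a)"
  using assms by (auto simp: value_class_def)

lemma value_class_self: "f \<in> carrier Hinf \<Longrightarrow> f \<in> value_class Z f"
  by (simp add: value_class_def)

lemma value_algebra_carrier:
  assumes "Z \<subseteq> unit_disk"
  shows "carrier (value_algebra Z) = value_class Z ` carrier Hinf"
  using rcoset_vanishing_ideal[OF assms] by (auto simp: FactRing_simps image_iff)

text \<open>The coset map is a ring homomorphism and scalars act on representatives; this lets the
  quotient be handled through representatives alone.\<close>

lemma value_algebra_ops:
  assumes Z: "Z \<subseteq> unit_disk" and f: "f \<in> carrier Hinf"
  shows "g \<in> carrier Hinf \<Longrightarrow>
      value_class Z f \<otimes>\<^bsub>value_algebra Z\<^esub> value_class Z g = value_class Z (f \<otimes>\<^bsub>Hinf\<^esub> g)"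
    and "g \<in> carrier Hinf \<Longrightarrow>
      value_class Z f \<oplus>\<^bsub>value_algebra Z\<^esub> value_class Z g = value_class Z (f \<oplus>\<^bsub>Hinf\<^esub> g)"
    and "\<one>\<^bsub>value_algebra Z\<^esub> = value_class Z \<one>\<^bsub>Hinf\<^esub>"
    and "c \<odot>\<^bsub>value_algebra Z\<^esub> value_class Z f = value_class Z (c \<odot>\<^bsub>Hinf\<^esub> f)"
proof -
  interpret I: ideal "vanishing_ideal Z" Hinf
    using Z by (rule ideal_vanishing_ideal)
  note hom = ring_hom_memE[OF I.rcos_ring_hom]
  note coset = rcoset_vanishing_ideal[OF Z]
  show "value_class Z f \<otimes>\<^bsub>value_algebra Z\<^esub> value_class Z g = value_class Z (f \<otimes>\<^bsub>Hinf\<^esub> g)"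
    if "g \<in> carrier Hinf"
    using hom(2)[OF f that] f that by (simp add: coset)
  show "value_class Z f \<oplus>\<^bsub>value_algebra Z\<^esub> value_class Z g = value_class Z (f \<oplus>\<^bsub>Hinf\<^esub> g)"
    if "g \<in> carrier Hinf"
    using hom(3)[OF f that] f that by (simp add: coset)
  show "\<one>\<^bsub>value_algebra Z\<^esub> = value_class Z \<one>\<^bsub>Hinf\<^esub>"
    using hom(4) by (simp add: coset)
  have "c \<in> carrier ring_of_type_algebra"
    by (simp add: ring_of_type_algebra_def)
  from quotient_smult_coset[OF algebra_Hinf I.ideal_axioms this f]
  show "c \<odot>\<^bsub>value_algebra Z\<^esub> value_class Z f = value_class Z (c \<odot>\<^bsub>Hinf\<^esub> f)"
    using f by (simp add: coset del: quotient_algebra_sel)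
qed

text \<open>A bounded analytic function that vanishes on \<open>Z\<close> is divisible by the
  Blaschke product with a bounded quotient, and the nonzero constant \<open>\<zeta>\<close> is
  absorbed into that quotient.\<close>

lemma PIdl_Blaschke:
  assumes Z: "finite Z" "Z \<subseteq> unit_disk" and \<Theta>: "\<Theta> \<in> carrier Hinf" and "\<zeta> \<noteq> 0"
    and eq: "\<And>z. z \<in> unit_disk \<Longrightarrow> \<Theta> z = \<zeta> * (\<Prod>a\<in>Z. Moebius_function 0 a z)"
  shows "PIdl\<^bsub>Hinf\<^esub> \<Theta> = vanishing_ideal Z"
proof (intro equalityI subsetI)
  have zero: "\<Theta> a = 0" "a \<in> unit_disk" if "a \<in> Z" for a
  proof -
    show a: "a \<in> unit_disk" using that Z(2) by blast
    have "(\<Prod>b\<in>Z. Moebius_function 0 b a) = 0"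
      using that Z(1) by (auto intro!: prod_zero bexI[of _ a] simp: Moebius_function_eq_zero)
    then show "\<Theta> a = 0" using eq[OF a] by simp
  qed
  show "f \<in> vanishing_ideal Z" if "f \<in> PIdl\<^bsub>Hinf\<^esub> \<Theta>" for f
    using that \<Theta> by (auto simp: cgenideal_def vanishing_ideal_def zero Hinf_apply(1)[OF zero(2)])
  show "f \<in> PIdl\<^bsub>Hinf\<^esub> \<Theta>" if f: "f \<in> vanishing_ideal Z" for f
  proof -
    obtain q where q: "q \<in> carrier Hinf"
      "\<And>z. z \<in> unit_disk \<Longrightarrow> f z = (\<Prod>a\<in>Z. Moebius_function 0 a z) * q z"
      using Hinf_divide_Blaschke[OF Z, of f] f unfolding vanishing_ideal_def by auto
    have "f = ((1 / \<zeta>) \<odot>\<^bsub>Hinf\<^esub> q) \<otimes>\<^bsub>Hinf\<^esub> \<Theta>"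
      using f q \<open>\<zeta> \<noteq> 0\<close> \<Theta> eq
      by (intro Hinf_eqI) (auto simp: vanishing_ideal_def simp del: mem_ball)
    then show ?thesis
      using q(1) by (auto simp: cgenideal_def)
  qed
qed

section \<open>Supremum norm and quotient norm\<close>

lemma norm_le_sup_norm:
  assumes "f \<in> carrier Hinf" "z \<in> unit_disk"
  shows "cmod (f z) \<le> sup_norm f"
proof -
  have "bdd_above ((\<lambda>z. cmod (f z)) ` unit_disk)"
    using Hinf_E[OF assms(1)] by (metis bdd_aboveI2)
  then show ?thesis
    unfolding sup_norm_def using assms(2) by (rule cSUP_upper2) simp
qed

lemma sup_norm_nonneg: "f \<in> carrier Hinf \<Longrightarrow> 0 \<le> sup_norm f"
  using order_trans[OF norm_ge_zero norm_le_sup_norm[of f 0]] by simp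

lemma quotient_norm_le:
  assumes "C \<subseteq> carrier Hinf" "f \<in> C"
  shows "quotient_norm sup_norm C \<le> sup_norm f"
  unfolding quotient_norm_def using assms sup_norm_nonneg
  by (intro cINF_lower) (auto intro!: bdd_belowI2[where m = 0])

text \<open>Representatives whose norms approach the infimum are uniformly bounded, so Montel's
  theorem yields a convergent subsequence. Pointwise convergence preserves the values on
  \<open>Z\<close>, and the bounds tend to \<open>m\<close>.\<close>

lemma quotient_norm_attained:
  assumes f: "f \<in> carrier Hinf" and Z: "Z \<subseteq> unit_disk"
  defines "m \<equiv> quotient_norm sup_norm (value_class Z f)"
  obtains g where "g \<in> value_class Z f" "\<And>z. z \<in> unit_disk \<Longrightarrow> cmod (g z) \<le> m"
proof -
  have "\<exists>g\<in>value_class Z f. sup_norm g < m + 1 / (real k + 1)" for k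
  proof (rule ccontr)
    assume "\<not> ?thesis"
    then have "m + 1 / (real k + 1) \<le> quotient_norm sup_norm (value_class Z f)"
      unfolding quotient_norm_def using value_class_self[OF f]
      by (intro cINF_greatest) (auto simp: not_less)
    then show False by (simp add: m_def)
  qed
  then obtain F where F: "\<And>k. F k \<in> value_class Z f" "\<And>k. sup_norm (F k) < m + 1 / (real k + 1)"
    by metis
  then have F_Hinf: "F k \<in> carrier Hinf" for k
    by (auto simp: value_class_def)
  then have F_le: "cmod (F k z) \<le> m + 1 / (real k + 1)" if "z \<in> unit_disk" for k z
    using norm_le_sup_norm[OF F_Hinf[of k] that] F(2)[of k] by linarith
  \<comment> \<open>Each error term is at most 1, which gives the one bound for all \<open>k\<close>
    that Montel's theorem needs.\<close>
  have F_le': "cmod (F k z) \<le> m + 1" if "z \<in> unit_disk" for k z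
    using F_le[OF that, of k] by (rule order_trans) (simp add: divide_le_eq)
  have F_hol: "h holomorphic_on unit_disk" if "h \<in> range F" for h
    using that F_Hinf by (auto simp: Hinf_def)
  have F_bd: "\<exists>B. \<forall>h\<in>range F. \<forall>z\<in>K. cmod (h z) \<le> B" if "K \<subseteq> unit_disk" for K
    by (intro exI[of _ "m + 1"] ballI) (use that F_le' in \<open>auto simp: image_iff\<close>)
  obtain g r where g: "g holomorphic_on unit_disk" and r: "strict_mono (r :: nat \<Rightarrow> nat)"
    and lim: "\<And>z. z \<in> unit_disk \<Longrightarrow> ((\<lambda>k. F (r k) z) \<longlongrightarrow> g z) sequentially"
    by (rule Montel[OF open_ball F_hol F_bd order_refl], assumption, assumption, rule that)
  have g_le: "cmod (g z) \<le> m" if z: "z \<in> unit_disk" for z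
  proof (rule tendsto_le[OF sequentially_bot])
    have "(\<lambda>k. 1 / (real k + 1)) \<longlonglongrightarrow> 0"
      using LIMSEQ_inverse_real_of_nat by (simp add: inverse_eq_divide add.commute)
    then have "(\<lambda>k. 1 / (real (r k) + 1)) \<longlonglongrightarrow> 0"
      using LIMSEQ_subseq_LIMSEQ[OF _ r] unfolding o_def by blast
    then show "(\<lambda>k. m + 1 / (real (r k) + 1)) \<longlonglongrightarrow> m"
      using tendsto_add[OF tendsto_const[of m]] by force
    show "(\<lambda>k. cmod (F (r k) z)) \<longlonglongrightarrow> cmod (g z)"
      by (intro tendsto_norm lim z)
  qed (use F_le[OF z] in simp)
  have "(\<lambda>z\<in>unit_disk. g z) \<in> carrier Hinf"
    using g g_le by (rule restrict_in_Hinf)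
  moreover have "g a = f a" if a: "a \<in> Z" for a
  proof (rule LIMSEQ_unique)
    show "(\<lambda>k. F (r k) a) \<longlonglongrightarrow> g a"
      using a Z by (intro lim) blast
    show "(\<lambda>k. F (r k) a) \<longlonglongrightarrow> f a"
      using F(1) a by (simp add: value_class_def)
  qed
  ultimately show thesis
    using Z g_le by (intro that[of "\<lambda>z\<in>unit_disk. g z"]) (auto simp: value_class_def)
qed

section \<open>Isomorphisms and self-maps of the disk\<close>

abbreviation disk_id :: "complex \<Rightarrow> complex" where
  "disk_id \<equiv> (\<lambda>z\<in>unit_disk. z)"

lemma disk_id_in_Hinf: "disk_id \<in> carrier Hinf"
  by (rule restrict_in_Hinf[where D = 1]) (auto intro: holomorphic_on_ident)

lemma sup_norm_disk_id: "sup_norm disk_id \<le> 1"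
  unfolding sup_norm_def by (rule cSUP_least) auto

text \<open>Only algebraic data are fixed, so that the inverse isomorphism becomes an instance of
  the same locale; the norm enters through an assumption of \<open>represented\<close>.\<close>

locale value_algebra_iso =
  fixes Z\<^sub>1 Z\<^sub>2 :: "complex set" and h
  assumes Z: "Z\<^sub>1 \<subseteq> unit_disk" "Z\<^sub>2 \<subseteq> unit_disk"
    and iso: "h \<in> algebra_iso (value_algebra Z\<^sub>1) (value_algebra Z\<^sub>2)"
begin

lemma ring_iso: "h \<in> ring_iso (value_algebra Z\<^sub>1) (value_algebra Z\<^sub>2)"
  using iso by (simp add: algebra_iso_def)

lemma class_in_carrier:
  "f \<in> carrier Hinf \<Longrightarrow> value_class Z\<^sub>1 f \<in> carrier (value_algebra Z\<^sub>1)"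
  using value_algebra_carrier[OF Z(1)] by blast

lemma h_smult:
  "f \<in> carrier Hinf \<Longrightarrow>
    h (c \<odot>\<^bsub>value_algebra Z\<^sub>1\<^esub> value_class Z\<^sub>1 f) = c \<odot>\<^bsub>value_algebra Z\<^sub>2\<^esub> h (value_class Z\<^sub>1 f)"
  using iso class_in_carrier unfolding algebra_iso_def by blast

text \<open>Any member of a class represents it. The lemmas below therefore speak of an arbitrary
  \<open>g\<close> in the image of the class of \<open>f\<close> instead of a chosen lift.\<close>

lemma h_class:
  assumes "f \<in> carrier Hinf" "g \<in> h (value_class Z\<^sub>1 f)"
  shows "g \<in> carrier Hinf" "h (value_class Z\<^sub>1 f) = value_class Z\<^sub>2 g"
proof -
  have "h (value_class Z\<^sub>1 f) \<in> value_class Z\<^sub>2 ` carrier Hinf"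
    using ring_iso_memE(1)[OF ring_iso class_in_carrier[OF assms(1)]] value_algebra_carrier[OF Z(2)]
    by simp
  then show "g \<in> carrier Hinf" "h (value_class Z\<^sub>1 f) = value_class Z\<^sub>2 g"
    using assms(2) by (auto simp: value_class_def)
qed

lemma h_nonempty:
  assumes "f \<in> carrier Hinf"
  obtains g where "g \<in> h (value_class Z\<^sub>1 f)"
proof -
  have "h (value_class Z\<^sub>1 f) \<in> value_class Z\<^sub>2 ` carrier Hinf"
    using ring_iso_memE(1)[OF ring_iso class_in_carrier[OF assms]] value_algebra_carrier[OF Z(2)]
    by simp
  then show thesis
    using that value_class_self by blast
qed

text \<open>Constants are scalar multiples of the unit, so compatibility with scalars fixes them; a
  mere ring isomorphism could, for example, conjugate them.\<close>

lemma h_const: "h (value_class Z\<^sub>1 (c \<odot>\<^bsub>Hinf\<^esub> \<one>\<^bsub>Hinf\<^esub>)) = value_class Z\<^sub>2 (c \<odot>\<^bsub>Hinf\<^esub> \<one>\<^bsub>Hinf\<^esub>)"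
proof -
  note one = Hinf_const_closed(1)
  have "h (c \<odot>\<^bsub>value_algebra Z\<^sub>1\<^esub> \<one>\<^bsub>value_algebra Z\<^sub>1\<^esub>) = c \<odot>\<^bsub>value_algebra Z\<^sub>2\<^esub> \<one>\<^bsub>value_algebra Z\<^sub>2\<^esub>"
    using h_smult[OF one, of c] ring_iso_memE(4)[OF ring_iso]
    by (simp only: value_algebra_ops(3)[OF Z(1) one] value_algebra_ops(3)[OF Z(2) one])
  then show ?thesis
    by (simp only: value_algebra_ops(3,4)[OF Z(1) one] value_algebra_ops(3,4)[OF Z(2) one])
qed

lemma h_add:
  assumes "f\<^sub>1 \<in> carrier Hinf" "f\<^sub>2 \<in> carrier Hinf"
    and "g\<^sub>1 \<in> h (value_class Z\<^sub>1 f\<^sub>1)" "g\<^sub>2 \<in> h (value_class Z\<^sub>1 f\<^sub>2)"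
  shows "h (value_class Z\<^sub>1 (f\<^sub>1 \<oplus>\<^bsub>Hinf\<^esub> f\<^sub>2)) = value_class Z\<^sub>2 (g\<^sub>1 \<oplus>\<^bsub>Hinf\<^esub> g\<^sub>2)"
proof -
  note g = h_class[OF assms(1,3)] h_class[OF assms(2,4)]
  show ?thesis
    using ring_iso_memE(3)[OF ring_iso class_in_carrier[OF assms(1)] class_in_carrier[OF assms(2)]]
    by (simp only: value_algebra_ops(2)[OF Z(1) assms(1,2)] value_algebra_ops(2)[OF Z(2) g(1,3)] g(2,4))
qed

lemma h_mult:
  assumes "f\<^sub>1 \<in> carrier Hinf" "f\<^sub>2 \<in> carrier Hinf"
    and "g\<^sub>1 \<in> h (value_class Z\<^sub>1 f\<^sub>1)" "g\<^sub>2 \<in> h (value_class Z\<^sub>1 f\<^sub>2)"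
  shows "h (value_class Z\<^sub>1 (f\<^sub>1 \<otimes>\<^bsub>Hinf\<^esub> f\<^sub>2)) = value_class Z\<^sub>2 (g\<^sub>1 \<otimes>\<^bsub>Hinf\<^esub> g\<^sub>2)"
proof -
  note g = h_class[OF assms(1,3)] h_class[OF assms(2,4)]
  show ?thesis
    using ring_iso_memE(2)[OF ring_iso class_in_carrier[OF assms(1)] class_in_carrier[OF assms(2)]]
    by (simp only: value_algebra_ops(1)[OF Z(1) assms(1,2)] value_algebra_ops(1)[OF Z(2) g(1,3)] g(2,4))
qed

text \<open>A point of \<open>Z\<^sub>2\<close> gives a character of the first quotient, and a character is evaluation at the
  image \<open>w\<close> of the identity because it annihilates \<open>f - f w = (z - w) q\<close>.\<close>
lemma h_eval:
  assumes \<phi>: "\<phi> \<in> h (value_class Z\<^sub>1 disk_id)" and b: "b \<in> Z\<^sub>2" "\<phi> b \<in> unit_disk"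
    and f: "f \<in> carrier Hinf" and g: "g \<in> h (value_class Z\<^sub>1 f)"
  shows "g b = f (\<phi> b)"
proof -
  define w where "w = \<phi> b"
  have b_in: "b \<in> unit_disk" using b(1) Z(2) by blast
  define const where "const = (\<lambda>c. c \<odot>\<^bsub>Hinf\<^esub> \<one>\<^bsub>Hinf\<^esub>)"
  have const: "const c \<in> carrier Hinf" "const c \<in> h (value_class Z\<^sub>1 (const c))" for c
    using h_const[of c] by (simp_all add: const_def value_class_self)
  have const_apply: "const c z = c" if "z \<in> unit_disk" for c z
    using that by (simp add: const_def)
  have "f \<oplus>\<^bsub>Hinf\<^esub> const (- f w) \<in> carrier Hinf"
    using f const(1) by simp
  moreover have "(f \<oplus>\<^bsub>Hinf\<^esub> const (- f w)) w = 0"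
    using b(2) by (simp add: w_def const_apply del: mem_ball)
  ultimately obtain q where q: "q \<in> carrier Hinf"
    "\<And>z. z \<in> unit_disk \<Longrightarrow> (f \<oplus>\<^bsub>Hinf\<^esub> const (- f w)) z = (z - w) * q z"
    using Hinf_divide_zero b(2) w_def by metis
  let ?d = "disk_id \<oplus>\<^bsub>Hinf\<^esub> const (- w)" and ?\<delta> = "\<phi> \<oplus>\<^bsub>Hinf\<^esub> const (- w)"
  have f_eq: "f = const (f w) \<oplus>\<^bsub>Hinf\<^esub> (?d \<otimes>\<^bsub>Hinf\<^esub> q)"
  proof (rule Hinf_eqI[OF f])
    show "const (f w) \<oplus>\<^bsub>Hinf\<^esub> (?d \<otimes>\<^bsub>Hinf\<^esub> q) \<in> carrier Hinf"
      using const(1) disk_id_in_Hinf q(1) by simp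
    fix z assume z: "z \<in> unit_disk"
    show "f z = (const (f w) \<oplus>\<^bsub>Hinf\<^esub> (?d \<otimes>\<^bsub>Hinf\<^esub> q)) z"
      using q(2)[OF z] z by (simp add: const_apply algebra_simps del: mem_ball)
  qed
  obtain p where p: "p \<in> h (value_class Z\<^sub>1 q)"
    using h_nonempty[OF q(1)] .
  note \<phi>_in = h_class(1)[OF disk_id_in_Hinf \<phi>]
  have d: "?d \<in> carrier Hinf" "?\<delta> \<in> h (value_class Z\<^sub>1 ?d)"
    using h_add[OF disk_id_in_Hinf const(1) \<phi> const(2)] const(1) disk_id_in_Hinf \<phi>_in
    by (simp_all add: value_class_self)
  have dq: "?d \<otimes>\<^bsub>Hinf\<^esub> q \<in> carrier Hinf" "?\<delta> \<otimes>\<^bsub>Hinf\<^esub> p \<in> h (value_class Z\<^sub>1 (?d \<otimes>\<^bsub>Hinf\<^esub> q))"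
    using h_mult[OF d(1) q(1) d(2) p] d(1) q(1) h_class(1)[OF d] h_class(1)[OF q(1) p]
    by (simp_all add: value_class_self)
  have "h (value_class Z\<^sub>1 f) = value_class Z\<^sub>2 (const (f w) \<oplus>\<^bsub>Hinf\<^esub> (?\<delta> \<otimes>\<^bsub>Hinf\<^esub> p))"
    using h_add[OF const(1)[of "f w"] dq(1) const(2)[of "f w"] dq(2)] by (simp only: f_eq[symmetric])
  with g have "g b = (const (f w) \<oplus>\<^bsub>Hinf\<^esub> (?\<delta> \<otimes>\<^bsub>Hinf\<^esub> p)) b"
    using b(1) by (simp add: value_class_def)
  \<comment> \<open>The factor \<open>?\<delta>\<close> vanishes at \<open>b\<close> since
    \<open>\<phi> b = w\<close>, so only the constant survives.\<close>
  also have "\<dots> = f w"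
    using b_in by (simp add: const_apply w_def del: mem_ball)
  finally show ?thesis by (simp add: w_def)
qed

text \<open>The ring part comes from \<open>ring_iso_set_sym\<close>. For scalars, every class of
  the target is \<open>h\<close> of a class, and applying \<open>k\<close> to the linearity of
  \<open>h\<close> there gives the linearity of \<open>k\<close>.\<close>

lemma inverse_iso:
  defines "k \<equiv> inv_into (carrier (value_algebra Z\<^sub>1)) h"
  shows "value_algebra_iso Z\<^sub>2 Z\<^sub>1 k"
proof
  show "Z\<^sub>2 \<subseteq> unit_disk" "Z\<^sub>1 \<subseteq> unit_disk" by (fact Z)+
  note bij = ring_iso_memE(5)[OF ring_iso]
  have "ring (value_algebra Z\<^sub>1)"
    using algebra_quotient[OF algebra_Hinf ideal_vanishing_ideal[OF Z(1)]]
    by (simp add: algebra_def cring_def)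
  then have "k \<in> ring_iso (value_algebra Z\<^sub>2) (value_algebra Z\<^sub>1)"
    unfolding k_def using ring_iso by (rule ring_iso_set_sym)
  moreover have "k (c \<odot>\<^bsub>value_algebra Z\<^sub>2\<^esub> C) = c \<odot>\<^bsub>value_algebra Z\<^sub>1\<^esub> k C"
    if C: "C \<in> carrier (value_algebra Z\<^sub>2)" for c C
  proof -
    have "C \<in> h ` value_class Z\<^sub>1 ` carrier Hinf"
      using C unfolding bij_betw_imp_surj_on[OF bij, symmetric] value_algebra_carrier[OF Z(1)] .
    then obtain f where f: "f \<in> carrier Hinf" "C = h (value_class Z\<^sub>1 f)"
      by blast
    have "c \<odot>\<^bsub>value_algebra Z\<^sub>1\<^esub> value_class Z\<^sub>1 f \<in> carrier (value_algebra Z\<^sub>1)"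
      using value_algebra_ops(4)[OF Z(1) f(1)] class_in_carrier[of "c \<odot>\<^bsub>Hinf\<^esub> f"] f(1) by simp
    then have "k (h (c \<odot>\<^bsub>value_algebra Z\<^sub>1\<^esub> value_class Z\<^sub>1 f)) = c \<odot>\<^bsub>value_algebra Z\<^sub>1\<^esub> value_class Z\<^sub>1 f"
      "k (h (value_class Z\<^sub>1 f)) = value_class Z\<^sub>1 f"
      unfolding k_def using class_in_carrier[OF f(1)] bij by (simp_all only: bij_betw_inv_into_left)
    then show ?thesis
      by (simp only: f(2) h_smult[OF f(1)])
  qed
  ultimately show "k \<in> algebra_iso (value_algebra Z\<^sub>2) (value_algebra Z\<^sub>1)"
    by (simp add: algebra_iso_def)
qed

end

section \<open>Self-maps of the disk induced by isometric isomorphisms\<close>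

text \<open>As usual for algebras of functions, \<open>\<phi>\<close> runs opposite to
  \<open>h\<close>: on \<open>Z\<^sub>2\<close> the isomorphism is composition with
  \<open>\<phi>\<close>. That \<open>\<phi>\<close> maps \<open>Z\<^sub>2\<close> into
  \<open>Z\<^sub>1\<close> is derived in \<open>represents_inverse\<close>.\<close>

definition represents ::
  "complex set \<Rightarrow> complex set \<Rightarrow> ((complex \<Rightarrow> complex) set \<Rightarrow> (complex \<Rightarrow> complex) set) \<Rightarrow>
   (complex \<Rightarrow> complex) \<Rightarrow> bool" where
  "represents Z\<^sub>1 Z\<^sub>2 h \<phi> \<longleftrightarrow>
     \<phi> holomorphic_on unit_disk \<and> (\<forall>z\<in>unit_disk. \<phi> z \<in> unit_disk) \<and>
     (\<forall>b\<in>Z\<^sub>2. \<forall>f\<in>carrier Hinf. \<forall>g\<in>h (value_class Z\<^sub>1 f). g b = f (\<phi> b))"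

text \<open>The identity has norm at most 1 and \<open>h\<close> does not increase norms, so a
  representative \<open>\<phi>\<close> of least norm in the image class is bounded by 1. If its
  values lie in the open disk, \<open>h_eval\<close> applies; otherwise it is a unimodular constant,
  which injectivity of \<open>h\<close> excludes.\<close>

lemma (in value_algebra_iso) represented:
  assumes ne: "Z\<^sub>1 \<noteq> {}"
    and isometric: "\<And>C. C \<in> carrier (value_algebra Z\<^sub>1) \<Longrightarrow>
      quotient_norm sup_norm (h C) \<le> quotient_norm sup_norm C"
  obtains \<phi> where "represents Z\<^sub>1 Z\<^sub>2 h \<phi>"
proof -
  \<comment> \<open>\<open>quotient_norm_attained\<close> speaks of a class given by a function;
    \<open>\<phi>\<^sub>0\<close> puts the image into that form.\<close>
  obtain \<phi>\<^sub>0 where \<phi>\<^sub>0: "\<phi>\<^sub>0 \<in> h (value_class Z\<^sub>1 disk_id)"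
    using h_nonempty[OF disk_id_in_Hinf] .
  note \<phi>\<^sub>0' = h_class[OF disk_id_in_Hinf \<phi>\<^sub>0]
  obtain \<phi> where \<phi>: "\<phi> \<in> h (value_class Z\<^sub>1 disk_id)"
    and le: "\<And>z. z \<in> unit_disk \<Longrightarrow> cmod (\<phi> z) \<le> quotient_norm sup_norm (h (value_class Z\<^sub>1 disk_id))"
    using quotient_norm_attained[OF \<phi>\<^sub>0'(1) Z(2)] unfolding \<phi>\<^sub>0'(2) by metis
  have "quotient_norm sup_norm (h (value_class Z\<^sub>1 disk_id)) \<le> quotient_norm sup_norm (value_class Z\<^sub>1 disk_id)"
    by (intro isometric class_in_carrier disk_id_in_Hinf)
  also have "\<dots> \<le> sup_norm disk_id"
    by (intro quotient_norm_le value_class_self disk_id_in_Hinf) (auto simp: value_class_def)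
  also have "\<dots> \<le> 1" by (rule sup_norm_disk_id)
  finally have le1: "cmod (\<phi> z) \<le> 1" if "z \<in> unit_disk" for z
    using le[OF that] by linarith
  have \<phi>_Hinf: "\<phi> \<in> carrier Hinf"
    using h_class(1)[OF disk_id_in_Hinf \<phi>] .
  then have hol: "\<phi> holomorphic_on unit_disk"
    by (simp add: Hinf_def)
  consider "\<forall>z\<in>unit_disk. \<phi> z \<in> unit_disk" | c where "cmod c = 1" "\<forall>z\<in>unit_disk. \<phi> z = c"
    using holomorphic_norm_le_1_cases[OF hol le1] by metis
  then show thesis
  proof cases
    case 1
    then have "represents Z\<^sub>1 Z\<^sub>2 h \<phi>"
      using hol h_eval[OF \<phi>] Z(2) unfolding represents_def by blast
    then show thesis by (rule that)
  next
    \<comment> \<open>Here the identity and the constant \<open>c\<close> would have the same image,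
      hence agree on \<open>Z\<^sub>1\<close>, and a point of \<open>Z\<^sub>1\<close> would have
      modulus 1.\<close>
    case (2 c)
    have "h (value_class Z\<^sub>1 disk_id) = h (value_class Z\<^sub>1 (c \<odot>\<^bsub>Hinf\<^esub> \<one>\<^bsub>Hinf\<^esub>))"
    proof -
      have "\<phi> = c \<odot>\<^bsub>Hinf\<^esub> \<one>\<^bsub>Hinf\<^esub>"
        using \<phi>_Hinf 2(2) by (intro Hinf_eqI) simp_all
      then show ?thesis
        using h_class(2)[OF disk_id_in_Hinf \<phi>] h_const by simp
    qed
    then have "value_class Z\<^sub>1 disk_id = value_class Z\<^sub>1 (c \<odot>\<^bsub>Hinf\<^esub> \<one>\<^bsub>Hinf\<^esub>)"
      using ring_iso_memE(5)[OF ring_iso] class_in_carrier disk_id_in_Hinf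
      unfolding bij_betw_def inj_on_def by (meson Hinf_const_closed(1) Hinf_smult_closed)
    moreover obtain a where "a \<in> Z\<^sub>1" "a \<in> unit_disk"
      using ne Z(1) by blast
    ultimately have "a = c"
      by (auto simp: value_class_eq_iff disk_id_in_Hinf dest: bspec[of _ _ a])
    then show thesis
      using 2(1) \<open>a \<in> unit_disk\<close> by simp
  qed
qed

text \<open>The class of \<open>\<Theta>\<close> is zero and is mapped to zero, so
  \<open>\<Theta>\<close> vanishes at \<open>\<phi> b\<close>, which places this point in
  \<open>Z\<^sub>1\<close>. For the second claim, a function in the \<open>k\<close>-image of the
  identity class is evaluated at \<open>\<phi> b\<close> in two ways.\<close>

lemma represents_inverse:
  assumes h: "represents Z\<^sub>1 Z\<^sub>2 h \<phi>" and k: "represents Z\<^sub>2 Z\<^sub>1 k \<eta>"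
    and "value_algebra_iso Z\<^sub>1 Z\<^sub>2 h" "value_algebra_iso Z\<^sub>2 Z\<^sub>1 k"
    and hk: "h (k (value_class Z\<^sub>2 disk_id)) = value_class Z\<^sub>2 disk_id"
    and \<Theta>: "\<Theta> \<in> carrier Hinf" "\<And>z. z \<in> unit_disk \<Longrightarrow> \<Theta> z = 0 \<longleftrightarrow> z \<in> Z\<^sub>1"
    and b: "b \<in> Z\<^sub>2"
  shows "\<phi> b \<in> Z\<^sub>1" "\<eta> (\<phi> b) = b"
proof -
  interpret h: value_algebra_iso Z\<^sub>1 Z\<^sub>2 h by fact
  interpret k: value_algebra_iso Z\<^sub>2 Z\<^sub>1 k by fact
  have b_in: "b \<in> unit_disk" "\<phi> b \<in> unit_disk"
    using b h.Z(2) h unfolding represents_def by blast+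
  \<comment> \<open>Zero is written as a multiple of the unit so that \<open>h_const\<close>
    applies.\<close>
  have "value_class Z\<^sub>1 \<Theta> = value_class Z\<^sub>1 (0 \<odot>\<^bsub>Hinf\<^esub> \<one>\<^bsub>Hinf\<^esub>)"
    using \<Theta> h.Z(1) by (subst value_class_eq_iff) auto
  then have "0 \<odot>\<^bsub>Hinf\<^esub> \<one>\<^bsub>Hinf\<^esub> \<in> h (value_class Z\<^sub>1 \<Theta>)"
    using h.h_const by (simp add: value_class_self)
  then have "\<Theta> (\<phi> b) = (0 \<odot>\<^bsub>Hinf\<^esub> \<one>\<^bsub>Hinf\<^esub>) b"
    using h b \<Theta>(1) unfolding represents_def by metis
  then show "\<phi> b \<in> Z\<^sub>1"
    using b_in \<Theta>(2) by simp
  obtain g where g: "g \<in> k (value_class Z\<^sub>2 disk_id)"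
    using k.h_nonempty[OF disk_id_in_Hinf] .
  note g' = k.h_class[OF disk_id_in_Hinf g]
  \<comment> \<open>As \<open>h\<close> sends the class of \<open>g\<close> back to that of the
    identity, \<open>g (\<phi> b)\<close> is \<open>b\<close>. Since \<open>\<phi> b\<close> lies in
    \<open>Z\<^sub>1\<close>, it is also \<open>\<eta> (\<phi> b)\<close>.\<close>
  have "disk_id \<in> h (value_class Z\<^sub>1 g)"
    using hk g'(2) value_class_self[OF disk_id_in_Hinf] by simp
  then have "g (\<phi> b) = disk_id b"
    using h b g'(1) unfolding represents_def by metis
  moreover have "g (\<phi> b) = disk_id (\<eta> (\<phi> b))"
    using k g \<open>\<phi> b \<in> Z\<^sub>1\<close> disk_id_in_Hinf unfolding represents_def by blast
  moreover have "\<eta> (\<phi> b) \<in> unit_disk"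
    using k b_in(2) unfolding represents_def by blast
  ultimately show "\<eta> (\<phi> b) = b"
    using b_in(1) by simp
qed

lemma isometrically_isomorphic_imp_automorphism:
  assumes Z: "Z\<^sub>1 \<subseteq> unit_disk" "Z\<^sub>2 \<subseteq> unit_disk"
    and card: "finite Z\<^sub>1" "finite Z\<^sub>2" "card Z\<^sub>1 = card Z\<^sub>2" "Z\<^sub>1 \<noteq> {}"
    and \<Theta>1: "\<Theta>1 \<in> carrier Hinf" "\<And>z. z \<in> unit_disk \<Longrightarrow> \<Theta>1 z = 0 \<longleftrightarrow> z \<in> Z\<^sub>1"
    and \<Theta>2: "\<Theta>2 \<in> carrier Hinf" "\<And>z. z \<in> unit_disk \<Longrightarrow> \<Theta>2 z = 0 \<longleftrightarrow> z \<in> Z\<^sub>2"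
    and "isometrically_isomorphic (value_algebra Z\<^sub>1) (quotient_norm sup_norm)
      (value_algebra Z\<^sub>2) (quotient_norm sup_norm)"
  obtains \<psi> where "disk_automorphism \<psi>" "\<psi> ` Z\<^sub>1 = Z\<^sub>2"
proof (cases "card Z\<^sub>1 = 1")
  \<comment> \<open>A single fixed point does not force a self-map to be the identity, so the
    automorphism is constructed directly.\<close>
  case True
  then obtain a b where "Z\<^sub>1 = {a}" "Z\<^sub>2 = {b}"
    using card(3) by (metis card_1_singletonE)
  then show thesis
    using disk_automorphism_moving[of a b] Z that by auto
next
  case False
  then have card2: "card Z\<^sub>1 \<ge> 2" "card Z\<^sub>2 \<ge> 2"
    using card card_gt_0_iff[of Z\<^sub>1] by linarith+
  obtain h where h: "h \<in> algebra_iso (value_algebra Z\<^sub>1) (value_algebra Z\<^sub>2)"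
    and norm: "\<And>C. C \<in> carrier (value_algebra Z\<^sub>1) \<Longrightarrow> quotient_norm sup_norm (h C) = quotient_norm sup_norm C"
    using assms unfolding isometrically_isomorphic_def by blast
  interpret h: value_algebra_iso Z\<^sub>1 Z\<^sub>2 h
    by (rule value_algebra_iso.intro[OF Z h])
  define k where "k = inv_into (carrier (value_algebra Z\<^sub>1)) h"
  interpret k: value_algebra_iso Z\<^sub>2 Z\<^sub>1 k
    unfolding k_def by (rule h.inverse_iso)
  note bij = ring_iso_memE(5)[OF h.ring_iso]
  have kh: "k (h C) = C" if "C \<in> carrier (value_algebra Z\<^sub>1)" for C
    unfolding k_def using bij that by (rule bij_betw_inv_into_left)
  have hk: "h (k C) = C" if "C \<in> carrier (value_algebra Z\<^sub>2)" for C
    unfolding k_def using bij that by (rule bij_betw_inv_into_right)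
  \<comment> \<open>The inverse is isometric too, which is what bounds its representing function by
    1.\<close>
  have k_norm: "quotient_norm sup_norm (k C) = quotient_norm sup_norm C"
    if "C \<in> carrier (value_algebra Z\<^sub>2)" for C
    using norm[OF ring_iso_memE(1)[OF k.ring_iso that]] hk[OF that] by simp
  have "Z\<^sub>2 \<noteq> {}" using card2 by auto
  obtain \<phi> where \<phi>: "represents Z\<^sub>1 Z\<^sub>2 h \<phi>"
    using h.represented[OF card(4)] norm by (metis order_refl)
  obtain \<eta> where \<eta>: "represents Z\<^sub>2 Z\<^sub>1 k \<eta>"
    using k.represented[OF \<open>Z\<^sub>2 \<noteq> {}\<close>] k_norm by (metis order_refl)
  have inv2: "\<phi> b \<in> Z\<^sub>1" "\<eta> (\<phi> b) = b" if "b \<in> Z\<^sub>2" for b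
    using represents_inverse[OF \<phi> \<eta> h.value_algebra_iso_axioms k.value_algebra_iso_axioms
        hk[OF k.class_in_carrier[OF disk_id_in_Hinf]] \<Theta>1 that] by blast+
  have inv1: "\<eta> a \<in> Z\<^sub>2" "\<phi> (\<eta> a) = a" if "a \<in> Z\<^sub>1" for a
    using represents_inverse[OF \<eta> \<phi> k.value_algebra_iso_axioms h.value_algebra_iso_axioms
        kh[OF h.class_in_carrier[OF disk_id_in_Hinf]] \<Theta>2 that] by blast+
  have \<phi>_map: "\<phi> holomorphic_on unit_disk" "\<And>z. z \<in> unit_disk \<Longrightarrow> \<phi> z \<in> unit_disk"
    and \<eta>_map: "\<eta> holomorphic_on unit_disk" "\<And>z. z \<in> unit_disk \<Longrightarrow> \<eta> z \<in> unit_disk"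
    using \<phi> \<eta> unfolding represents_def by blast+
  \<comment> \<open>Infinite sets have \<open>card\<close> equal to 0, so the bound includes
    finiteness.\<close>
  have two: "\<exists>p\<in>Z. \<exists>q\<in>Z. p \<noteq> q" if "card Z \<ge> 2" for Z :: "complex set"
    using that card_le_Suc0_iff_eq[of Z] card.infinite[of Z] by (cases "finite Z") fastforce+
  have "\<phi> (\<eta> z) = z" if z: "z \<in> unit_disk" for z
  proof -
    obtain p q where "p \<in> Z\<^sub>1" "q \<in> Z\<^sub>1" "p \<noteq> q" using two[OF card2(1)] by blast
    then show ?thesis
      using self_map_two_fixed_points[OF holomorphic_compose_disk[OF \<phi>_map(1) \<eta>_map]
          \<phi>_map(2)[OF \<eta>_map(2)] _ _ _ _ _ z, of p q] inv1 Z(1) by blast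
  qed
  moreover have "\<eta> (\<phi> z) = z" if z: "z \<in> unit_disk" for z
  proof -
    obtain p q where "p \<in> Z\<^sub>2" "q \<in> Z\<^sub>2" "p \<noteq> q" using two[OF card2(2)] by blast
    then show ?thesis
      using self_map_two_fixed_points[OF holomorphic_compose_disk[OF \<eta>_map(1) \<phi>_map]
          \<eta>_map(2)[OF \<phi>_map(2)] _ _ _ _ _ z, of p q] inv2 Z(2) by blast
  qed
  \<comment> \<open>Of the two self-maps, \<open>\<eta>\<close> is the one that leads from
    \<open>Z\<^sub>1\<close> to \<open>Z\<^sub>2\<close>.\<close>
  ultimately have "disk_automorphism \<eta>"
    using disk_automorphismI[OF \<eta>_map(1) \<phi>_map(1) \<eta>_map(2) \<phi>_map(2)] by blast
  moreover have "\<eta> ` Z\<^sub>1 = Z\<^sub>2"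
    using inv1(1) inv2 by (metis image_subsetI image_eqI subsetI subset_antisym)
  ultimately show thesis by (rule that)
qed

section \<open>Isomorphisms induced by automorphisms\<close>

text \<open>Composition with the inverse of \<open>\<psi>\<close> is an isometric automorphism of
  \<open>Hinf\<close> that carries the classes for \<open>Z\<close> onto the classes for its image,
  so it descends to the quotients.\<close>

lemma automorphism_imp_isometrically_isomorphic:
  assumes \<psi>: "disk_automorphism \<psi>" and Z: "Z \<subseteq> unit_disk"
  shows "isometrically_isomorphic (value_algebra Z) (quotient_norm sup_norm)
    (value_algebra (\<psi> ` Z)) (quotient_norm sup_norm)"
proof -
  define \<phi> where "\<phi> = inv_into unit_disk \<psi>"
  note \<psi> = disk_automorphism_inv_into[OF \<psi>, folded \<phi>_def]
  have Z': "\<psi> ` Z \<subseteq> unit_disk"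
    using \<psi>(3) Z by (auto simp del: mem_ball)
  \<comment> \<open>The inverse \<open>\<phi>\<close> appears in \<open>T\<close> because a value at
    \<open>a\<close> has to become a value at \<open>\<psi> a\<close>; \<open>S\<close> inverts
    \<open>T\<close>.\<close>
  define T where "T = (\<lambda>f. \<lambda>z\<in>unit_disk. f (\<phi> z) :: complex)"
  define S where "S = (\<lambda>f. \<lambda>z\<in>unit_disk. f (\<psi> z) :: complex)"
  have comp_Hinf: "(\<lambda>z\<in>unit_disk. f (\<rho> z)) \<in> carrier Hinf"
    if f: "f \<in> carrier Hinf" and \<rho>: "\<rho> holomorphic_on unit_disk" "\<And>z. z \<in> unit_disk \<Longrightarrow> \<rho> z \<in> unit_disk"
    for f \<rho>
  proof (rule restrict_in_Hinf)
    show "(\<lambda>z. f (\<rho> z)) holomorphic_on unit_disk"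
      using f by (intro holomorphic_compose_disk[OF _ \<rho>]) (simp add: Hinf_def)
    show "cmod (f (\<rho> z)) \<le> sup_norm f" if "z \<in> unit_disk" for z
      using norm_le_sup_norm[OF f \<rho>(2)[OF that]] .
  qed
  have T_Hinf: "T f \<in> carrier Hinf" and S_Hinf: "S f \<in> carrier Hinf" if "f \<in> carrier Hinf" for f
    unfolding T_def S_def using comp_Hinf[OF that \<psi>(2,4)] comp_Hinf[OF that \<psi>(1,3)] by blast+
  have T_apply: "T f z = f (\<phi> z)" and S_apply: "S f z = f (\<psi> z)" if "z \<in> unit_disk" for f z
    using that by (simp_all add: T_def S_def)
  have TS: "T (S f) = f" and ST: "S (T f) = f" if "f \<in> carrier Hinf" for f
    using that \<psi>(3-6) by (auto intro!: Hinf_eqI T_Hinf S_Hinf simp: T_apply S_apply simp del: mem_ball)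
  have T_ops: "T (f \<oplus>\<^bsub>Hinf\<^esub> g) = T f \<oplus>\<^bsub>Hinf\<^esub> T g" "T (f \<otimes>\<^bsub>Hinf\<^esub> g) = T f \<otimes>\<^bsub>Hinf\<^esub> T g"
    "T (c \<odot>\<^bsub>Hinf\<^esub> f) = c \<odot>\<^bsub>Hinf\<^esub> T f" "T \<one>\<^bsub>Hinf\<^esub> = \<one>\<^bsub>Hinf\<^esub>"
    if "f \<in> carrier Hinf" "g \<in> carrier Hinf" for f g c
    using that \<psi>(4) by (auto intro!: Hinf_eqI simp: T_apply T_Hinf simp del: mem_ball)
  have T_norm: "sup_norm (T f) = sup_norm f" for f
  proof -
    have "(\<lambda>z. cmod (T f z)) ` unit_disk = (\<lambda>z. cmod (f z)) ` \<phi> ` unit_disk"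
      by (auto simp: T_apply image_image simp del: mem_ball intro!: image_cong)
    moreover have "\<phi> ` unit_disk = unit_disk"
      using \<psi>(3-5) by (metis image_subsetI image_eqI subsetI subset_antisym)
    ultimately show ?thesis
      by (simp add: sup_norm_def)
  qed
  have T_class: "T ` value_class Z f = value_class (\<psi> ` Z) (T f)" if f: "f \<in> carrier Hinf" for f
  proof (intro equalityI subsetI)
    have Zd: "\<phi> (\<psi> a) = a" "\<psi> a \<in> unit_disk" "a \<in> unit_disk" if "a \<in> Z" for a
      using that Z \<psi>(3,5) by blast+
    show "g \<in> value_class (\<psi> ` Z) (T f)" if "g \<in> T ` value_class Z f" for g
      using that T_Hinf by (auto simp: value_class_def T_apply[OF Zd(2)] Zd(1))
    show "g \<in> T ` value_class Z f" if g: "g \<in> value_class (\<psi> ` Z) (T f)" for g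
    proof (rule image_eqI)
      show "g = T (S g)" using g TS by (simp add: value_class_def)
      show "S g \<in> value_class Z f"
        using g S_Hinf by (auto simp: value_class_def S_apply[OF Zd(3)] T_apply[OF Zd(2)] Zd(1))
    qed
  qed
  let ?h = "\<lambda>C. T ` C"
  note carrier = value_algebra_carrier[OF Z] and carrier' = value_algebra_carrier[OF Z']
  note ops = value_algebra_ops[OF Z] and ops' = value_algebra_ops[OF Z']
  have "?h \<in> ring_iso (value_algebra Z) (value_algebra (\<psi> ` Z))"
  proof (rule ring_iso_memI)
    show "?h C \<in> carrier (value_algebra (\<psi> ` Z))" if "C \<in> carrier (value_algebra Z)" for C
      using that T_Hinf unfolding carrier carrier' by (auto simp: T_class)
    show "?h (C \<otimes>\<^bsub>value_algebra Z\<^esub> D) = ?h C \<otimes>\<^bsub>value_algebra (\<psi> ` Z)\<^esub> ?h D"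
      "?h (C \<oplus>\<^bsub>value_algebra Z\<^esub> D) = ?h C \<oplus>\<^bsub>value_algebra (\<psi> ` Z)\<^esub> ?h D"
      if CD: "C \<in> carrier (value_algebra Z)" "D \<in> carrier (value_algebra Z)" for C D
    proof -
      obtain f g where fg: "f \<in> carrier Hinf" "g \<in> carrier Hinf" "C = value_class Z f" "D = value_class Z g"
        using CD unfolding carrier by blast
      show "?h (C \<otimes>\<^bsub>value_algebra Z\<^esub> D) = ?h C \<otimes>\<^bsub>value_algebra (\<psi> ` Z)\<^esub> ?h D"
        using fg(1,2) by (simp only: fg(3,4) ops(1) ops'(1) T_class T_ops Hinf_closed T_Hinf)
      show "?h (C \<oplus>\<^bsub>value_algebra Z\<^esub> D) = ?h C \<oplus>\<^bsub>value_algebra (\<psi> ` Z)\<^esub> ?h D"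
        using fg(1,2) by (simp only: fg(3,4) ops(2) ops'(2) T_class T_ops Hinf_closed T_Hinf)
    qed
    show "?h \<one>\<^bsub>value_algebra Z\<^esub> = \<one>\<^bsub>value_algebra (\<psi> ` Z)\<^esub>"
      using Hinf_const_closed(1) T_ops(4)[of "\<one>\<^bsub>Hinf\<^esub>" "\<one>\<^bsub>Hinf\<^esub>"]
      by (simp only: ops(3)[OF Hinf_const_closed(1)] ops'(3)[OF Hinf_const_closed(1)] T_class)
    \<comment> \<open>The map on cosets is the image map of \<open>T\<close>, so injectivity of
      \<open>T\<close> on the union of all cosets suffices.\<close>
    have "inj_on T (carrier Hinf)"
      by (rule inj_on_inverseI[where g = S]) (rule ST)
    moreover have "\<Union> (carrier (value_algebra Z)) \<subseteq> carrier Hinf"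
      unfolding carrier by (auto simp: value_class_def)
    ultimately have "inj_on ?h (carrier (value_algebra Z))"
      by (intro inj_on_image) (rule inj_on_subset)
    moreover have "?h ` carrier (value_algebra Z) = carrier (value_algebra (\<psi> ` Z))"
    proof -
      have "?h ` carrier (value_algebra Z) = value_class (\<psi> ` Z) ` T ` carrier Hinf"
        unfolding carrier image_image by (intro image_cong refl T_class)
      moreover have "T ` carrier Hinf = carrier Hinf"
      proof (intro equalityI subsetI)
        show "f \<in> carrier Hinf" if "f \<in> T ` carrier Hinf" for f
          using that T_Hinf by blast
        show "f \<in> T ` carrier Hinf" if "f \<in> carrier Hinf" for f
          using TS[OF that, symmetric] S_Hinf[OF that] by (rule image_eqI)
      qed
      ultimately show ?thesis
        unfolding carrier' by simp
    qed
    ultimately show "bij_betw ?h (carrier (value_algebra Z)) (carrier (value_algebra (\<psi> ` Z)))"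
      by (simp add: bij_betw_def)
  qed
  moreover have "?h (c \<odot>\<^bsub>value_algebra Z\<^esub> C) = c \<odot>\<^bsub>value_algebra (\<psi> ` Z)\<^esub> ?h C"
    if C: "C \<in> carrier (value_algebra Z)" for c C
  proof -
    obtain f where f: "f \<in> carrier Hinf" "C = value_class Z f"
      using C unfolding carrier by blast
    show ?thesis
      using f(1) by (simp only: f(2) ops(4) ops'(4) T_class T_ops Hinf_smult_closed T_Hinf)
  qed
  ultimately have "?h \<in> algebra_iso (value_algebra Z) (value_algebra (\<psi> ` Z))"
    by (simp add: algebra_iso_def)
  \<comment> \<open>Both infima run over the same norms, since \<open>T\<close> preserves each of
    them.\<close>
  moreover have "quotient_norm sup_norm (?h C) = quotient_norm sup_norm C" for C
    by (simp add: quotient_norm_def image_image T_norm)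
  ultimately show ?thesis
    unfolding isometrically_isomorphic_def by blast
qed

section \<open>Comparison of the two Blaschke products\<close>

theorem corollary5p4:
  fixes \<Theta>1 \<Theta>2 :: "complex \<Rightarrow> complex" and n :: nat
  assumes "n \<ge> 1"
    and "Blaschke_with_distinct_zeros n \<Theta>1"
    and "Blaschke_with_distinct_zeros n \<Theta>2"
  shows "isometrically_isomorphic
           (Hinf_quotient \<Theta>1) (quotient_norm sup_norm)
           (Hinf_quotient \<Theta>2) (quotient_norm sup_norm)
     \<longleftrightarrow> (\<exists>\<zeta> \<psi>. cmod \<zeta> = 1 \<and> disk_automorphism \<psi> \<and>
            (\<forall>z\<in>unit_disk. \<Theta>1 z = \<zeta> * \<Theta>2 (\<psi> z)))"
proof -
  obtain \<zeta>\<^sub>1 Z\<^sub>1 where Z1: "finite Z\<^sub>1" "card Z\<^sub>1 = n" "Z\<^sub>1 \<subseteq> unit_disk" and \<zeta>1: "cmod \<zeta>\<^sub>1 = 1"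
    and \<Theta>1: "\<Theta>1 \<in> carrier Hinf" "\<And>z. z \<in> unit_disk \<Longrightarrow> \<Theta>1 z = \<zeta>\<^sub>1 * (\<Prod>a\<in>Z\<^sub>1. Moebius_function 0 a z)"
    using Blaschke_with_distinct_zerosE[OF assms(2)] by metis
  obtain \<zeta>\<^sub>2 Z\<^sub>2 where Z2: "finite Z\<^sub>2" "card Z\<^sub>2 = n" "Z\<^sub>2 \<subseteq> unit_disk" and \<zeta>2: "cmod \<zeta>\<^sub>2 = 1"
    and \<Theta>2: "\<Theta>2 \<in> carrier Hinf" "\<And>z. z \<in> unit_disk \<Longrightarrow> \<Theta>2 z = \<zeta>\<^sub>2 * (\<Prod>a\<in>Z\<^sub>2. Moebius_function 0 a z)"
    using Blaschke_with_distinct_zerosE[OF assms(3)] by metis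
  have nz: "\<zeta>\<^sub>1 \<noteq> 0" "\<zeta>\<^sub>2 \<noteq> 0" using \<zeta>1 \<zeta>2 by auto
  \<comment> \<open>The quotients are determined by the zero sets, and both directions compare
    these.\<close>
  have quotients: "Hinf_quotient \<Theta>1 = value_algebra Z\<^sub>1" "Hinf_quotient \<Theta>2 = value_algebra Z\<^sub>2"
    using PIdl_Blaschke[OF Z1(1,3) \<Theta>1(1) nz(1) \<Theta>1(2)] PIdl_Blaschke[OF Z2(1,3) \<Theta>2(1) nz(2) \<Theta>2(2)]
    by (simp_all add: Hinf_quotient_def)
  have prod0: "(\<Prod>a\<in>Z. Moebius_function 0 a z) = 0 \<longleftrightarrow> z \<in> Z"
    if "finite Z" "Z \<subseteq> unit_disk" "z \<in> unit_disk" for Z z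
  proof -
    have "Moebius_function 0 a z = 0 \<longleftrightarrow> z = a" if "a \<in> Z" for a
      using that \<open>Z \<subseteq> unit_disk\<close> \<open>z \<in> unit_disk\<close> by (intro Moebius_eq_0_iff) blast
    then show ?thesis
      using that(1) by (simp add: prod_zero_iff)
  qed
  have zeros1: "\<Theta>1 z = 0 \<longleftrightarrow> z \<in> Z\<^sub>1" and zeros2: "\<Theta>2 z = 0 \<longleftrightarrow> z \<in> Z\<^sub>2" if "z \<in> unit_disk" for z
    using \<Theta>1(2)[OF that] \<Theta>2(2)[OF that] prod0[OF Z1(1,3) that] prod0[OF Z2(1,3) that] nz by simp_all
  show ?thesis
    unfolding quotients
  proof
    assume "isometrically_isomorphic (value_algebra Z\<^sub>1) (quotient_norm sup_norm)
      (value_algebra Z\<^sub>2) (quotient_norm sup_norm)"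
    moreover have "Z\<^sub>1 \<noteq> {}" using Z1(2) assms(1) by auto
    ultimately obtain \<psi> where \<psi>: "disk_automorphism \<psi>" "\<psi> ` Z\<^sub>1 = Z\<^sub>2"
      using isometrically_isomorphic_imp_automorphism[of Z\<^sub>1 Z\<^sub>2 \<Theta>1 \<Theta>2] Z1 Z2 \<Theta>1(1) \<Theta>2(1) zeros1 zeros2
      by metis
    \<comment> \<open>Each Blaschke factor picks up its own rotation constant under
      \<open>\<psi>\<close>; \<open>u\<close> below collects them together with
      \<open>\<zeta>\<^sub>2\<close>.\<close>
    have "\<exists>c. \<forall>a\<in>Z\<^sub>1. cmod (c a) = 1 \<and>
      (\<forall>z\<in>unit_disk. Moebius_function 0 (\<psi> a) (\<psi> z) = c a * Moebius_function 0 a z)"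
      using Moebius_disk_automorphism[OF \<psi>(1)] Z1(3) by (intro bchoice ballI) (metis subsetD)
    then obtain c where c: "\<And>a. a \<in> Z\<^sub>1 \<Longrightarrow> cmod (c a) = 1"
      "\<And>a z. a \<in> Z\<^sub>1 \<Longrightarrow> z \<in> unit_disk \<Longrightarrow>
        Moebius_function 0 (\<psi> a) (\<psi> z) = c a * Moebius_function 0 a z"
      by blast
    have inj: "inj_on \<psi> Z\<^sub>1"
      using \<psi>(1) Z1(3) by (auto simp: disk_automorphism_def bij_betw_def intro: inj_on_subset)
    define u where "u = \<zeta>\<^sub>2 * (\<Prod>a\<in>Z\<^sub>1. c a)"
    have u: "cmod u = 1"
      using \<zeta>2 c(1) by (simp add: u_def norm_mult prod_norm[symmetric])
    have "\<Theta>1 z = (\<zeta>\<^sub>1 / u) * \<Theta>2 (\<psi> z)" if z: "z \<in> unit_disk" for z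
    proof -
      \<comment> \<open>As \<open>\<psi>\<close> is injective on \<open>Z\<^sub>1\<close>, the
        factors of \<open>\<Theta>2\<close> can be reindexed by the zeros of
        \<open>\<Theta>1\<close>.\<close>
      have "\<Theta>2 (\<psi> z) = \<zeta>\<^sub>2 * (\<Prod>a\<in>Z\<^sub>1. Moebius_function 0 (\<psi> a) (\<psi> z))"
        using \<Theta>2(2)[OF disk_automorphism_inv_into(3)[OF \<psi>(1) z]] inj
        by (simp add: \<psi>(2)[symmetric] prod.reindex)
      also have "\<dots> = u * (\<Prod>a\<in>Z\<^sub>1. Moebius_function 0 a z)"
        using c(2)[OF _ z] by (simp add: u_def prod.distrib)
      finally show ?thesis
        using \<Theta>1(2)[OF z] u by auto
    qed
    moreover have "cmod (\<zeta>\<^sub>1 / u) = 1"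
      using u \<zeta>1 by (simp add: norm_divide)
    ultimately show "\<exists>\<zeta> \<psi>. cmod \<zeta> = 1 \<and> disk_automorphism \<psi> \<and> (\<forall>z\<in>unit_disk. \<Theta>1 z = \<zeta> * \<Theta>2 (\<psi> z))"
      using \<psi>(1) by blast
  next
    assume "\<exists>\<zeta> \<psi>. cmod \<zeta> = 1 \<and> disk_automorphism \<psi> \<and> (\<forall>z\<in>unit_disk. \<Theta>1 z = \<zeta> * \<Theta>2 (\<psi> z))"
    then obtain \<zeta> \<psi> where \<zeta>: "cmod \<zeta> = 1" and \<psi>: "disk_automorphism \<psi>"
      and eq: "\<And>z. z \<in> unit_disk \<Longrightarrow> \<Theta>1 z = \<zeta> * \<Theta>2 (\<psi> z)"
      by blast
    note inv = disk_automorphism_inv_into[OF \<psi>]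
    \<comment> \<open>A unimodular factor does not change zeros, so the relation matches the zeros
      under \<open>\<psi>\<close>; surjectivity of \<open>\<psi>\<close> then gives all of
      \<open>Z\<^sub>2\<close>.\<close>
    have iff: "z \<in> Z\<^sub>1 \<longleftrightarrow> \<psi> z \<in> Z\<^sub>2" if "z \<in> unit_disk" for z
      using eq[OF that] zeros1[OF that] zeros2[OF inv(3)[OF that]] \<zeta> by auto
    have "\<psi> ` Z\<^sub>1 = Z\<^sub>2"
    proof (intro equalityI subsetI)
      show "w \<in> Z\<^sub>2" if "w \<in> \<psi> ` Z\<^sub>1" for w
        using that iff Z1(3) by blast
      show "w \<in> \<psi> ` Z\<^sub>1" if "w \<in> Z\<^sub>2" for w
        using that iff[OF inv(4)] inv(6) Z2(3) by (metis image_eqI subsetD)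
    qed
    then show "isometrically_isomorphic (value_algebra Z\<^sub>1) (quotient_norm sup_norm)
      (value_algebra Z\<^sub>2) (quotient_norm sup_norm)"
      using automorphism_imp_isometrically_isomorphic[OF \<psi> Z1(3)] by simp
  qed
qed

end
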